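(* Let $\Gamma$ be a finitely generated group. Let $\mu_1$ and $\mu_2$ be admissible probability measures on $\Gamma$, with spectral distributions $N_{\mu_1}$ and $N_{\mu_2}$ of the associated Laplace operators. Then, near zero and in the dilatational sense, $$N_{\mu_1}\simeq N_{\mu_2}.$$
   Context: Admissible measures: a probability measure $\mu$ on a finitely generated group $\Gamma$ is admissible if it is symmetric ($\mu(\{\gamma\})=\mu(\{\gamma^{-1}\})$ for all $\gamma$), has finite second moment ($\int_\Gamma l(\gamma)^2\,d\mu(\gamma)<\infty$, with $l$ the length function of some word metric on $\Gamma$), and its support contains a finite generating set of $\Gamma$. Operators: $R_\mu:l^2(\Gamma)\to l^2(\Gamma)$, $R_\mu(f)(x)=\sum_{\gamma\in\Gamma}f(x\gamma^{-1})\mu(\gamma)$, and $\Delta_\mu=\mathrm{id}-R_\mu$, a positive bounded operator. For a bounded self-adjoint operator $A$ put $E^A_\lambda=\chi_{(-\infty,\lambda]}(A)$. For a bounded operator $A$ on $l^2(\Gamma)$ commuting with the left $\Gamma$-action, $\mathrm{tr}_\Gamma(A)=\langle A\delta_e,\delta_e\rangle$. The spectral distribution of $\Delta_\mu$ is $N_\mu:[0,\infty)\to[0,\infty)$, $N_\mu(\lambda)=\mathrm{tr}_\Gamma(E^{\Delta_\mu}_\lambda)$. Asymptotic comparison: for $f,g:[0,\infty)\to[0,\infty)$, $f\preceq g$ near zero in the dilatational sense means that there are $D,\epsilon>0$ with $f(\lambda)\le g(D\lambda)$ for all $\lambda\in[0,\epsilon)$; $f\simeq g$ means $f\preceq g$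 and $g\preceq f$. *)

theory Defs
  imports
    "HOL-Algebra.Generated_Groups"
    "HOL-Probability.Probability"
begin

section \<open>Finitely generated groups and admissible measures\<close>

definition finite_generating_set :: "('a, 'b) monoid_scheme \<Rightarrow> 'a set \<Rightarrow> bool" where
  "finite_generating_set G S \<longleftrightarrow> finite S \<and> S \<subseteq> carrier G \<and> generate G S = carrier G"

definition finitely_generated :: "('a, 'b) monoid_scheme \<Rightarrow> bool" where
  "finitely_generated G \<longleftrightarrow> (\<exists>S. finite_generating_set G S)"

definition word_length :: "('a, 'b) monoid_scheme \<Rightarrow> 'a set \<Rightarrow> 'a \<Rightarrow> nat" where
  "word_length G S g =
     (LEAST n. \<exists>ws. length ws = n \<and> set ws \<subseteq> S \<union> (\<lambda>s. inv\<^bsub>G\<^esub> s) ` S \<and>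
                    foldr (\<lambda>s h. s \<otimes>\<^bsub>G\<^esub> h) ws \<one>\<^bsub>G\<^esub> = g)"

definition admissible :: "('a, 'b) monoid_scheme \<Rightarrow> 'a pmf \<Rightarrow> bool" where
  "admissible G \<mu> \<longleftrightarrow>
     set_pmf \<mu> \<subseteq> carrier G \<and>
     (\<forall>g\<in>carrier G. pmf \<mu> g = pmf \<mu> (inv\<^bsub>G\<^esub> g)) \<and>
     (\<exists>S. finite_generating_set G S \<and>
          integrable (measure_pmf \<mu>) (\<lambda>g. (real (word_length G S g))\<^sup>2)) \<and>
     (\<exists>S. finite_generating_set G S \<and> S \<subseteq> set_pmf \<mu>)"

section \<open>The complex Hilbert space of square-summable functions on a set\<close>

text \<open>Functions on \<open>X\<close> are represented by their extension by zero.\<close>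

definition l2 :: "'a set \<Rightarrow> ('a \<Rightarrow> complex) set" where
  "l2 X = {f. (\<forall>x. x \<notin> X \<longrightarrow> f x = 0) \<and> (\<lambda>x. (cmod (f x))\<^sup>2) summable_on X}"

definition l2_inner :: "'a set \<Rightarrow> ('a \<Rightarrow> complex) \<Rightarrow> ('a \<Rightarrow> complex) \<Rightarrow> complex" where
  "l2_inner X f g = (\<Sum>\<^sub>\<infinity>x\<in>X. f x * cnj (g x))"

definition l2_norm :: "'a set \<Rightarrow> ('a \<Rightarrow> complex) \<Rightarrow> real" where
  "l2_norm X f = sqrt (\<Sum>\<^sub>\<infinity>x\<in>X. (cmod (f x))\<^sup>2)"

definition point_mass :: "'a \<Rightarrow> 'a \<Rightarrow> complex" where
  "point_mass x = (\<lambda>y. if y = x then 1 else 0)"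

definition bounded_op :: "'a set \<Rightarrow> (('a \<Rightarrow> complex) \<Rightarrow> ('a \<Rightarrow> complex)) \<Rightarrow> bool" where
  "bounded_op X T \<longleftrightarrow>
     T \<in> l2 X \<rightarrow>\<^sub>E l2 X \<and>
     (\<forall>f\<in>l2 X. \<forall>g\<in>l2 X. T (\<lambda>x. f x + g x) = (\<lambda>x. T f x + T g x)) \<and>
     (\<forall>c. \<forall>f\<in>l2 X. T (\<lambda>x. c * f x) = (\<lambda>x. c * T f x)) \<and>
     (\<exists>K. \<forall>f\<in>l2 X. l2_norm X (T f) \<le> K * l2_norm X f)"

section \<open>Borel functional calculus\<close>

text \<open>
  For a bounded self-adjoint operator \<open>A\<close>, the spectral measure of \<open>A\<close> at the vector \<open>f\<close> is
  the compactly supported finite Borel measure \<open>M\<close> on the real line with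
  \<open>\<langle>p(A) f, f\<rangle> = \<integral> p dM\<close> for all polynomials \<open>p\<close>. For a bounded Borel function \<open>\<phi>\<close>, the
  operator \<open>\<phi>(A)\<close> is the bounded operator with \<open>\<langle>\<phi>(A) f, f\<rangle> = \<integral> \<phi> dM\<close> for every vector \<open>f\<close>.
\<close>

definition spectral_measure ::
  "'a set \<Rightarrow> (('a \<Rightarrow> complex) \<Rightarrow> ('a \<Rightarrow> complex)) \<Rightarrow> ('a \<Rightarrow> complex) \<Rightarrow> real measure" where
  "spectral_measure X A f =
     (THE M. sets M = sets borel \<and> finite_measure M \<and>
             (\<exists>a b. AE t in M. a \<le> t \<and> t \<le> b) \<and>
             (\<forall>n::nat. l2_inner X ((A ^^ n) f) f = complex_of_real (\<integral>t. t ^ n \<partial>M)))"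

definition borel_calculus ::
  "'a set \<Rightarrow> (('a \<Rightarrow> complex) \<Rightarrow> ('a \<Rightarrow> complex)) \<Rightarrow> (real \<Rightarrow> real) \<Rightarrow>
     (('a \<Rightarrow> complex) \<Rightarrow> ('a \<Rightarrow> complex))" where
  "borel_calculus X A \<phi> =
     (THE T. bounded_op X T \<and>
             (\<forall>f\<in>l2 X. l2_inner X (T f) f =
                        complex_of_real (\<integral>t. \<phi> t \<partial>spectral_measure X A f)))"

definition spectral_projection ::
  "'a set \<Rightarrow> (('a \<Rightarrow> complex) \<Rightarrow> ('a \<Rightarrow> complex)) \<Rightarrow> real \<Rightarrow>
     (('a \<Rightarrow> complex) \<Rightarrow> ('a \<Rightarrow> complex))" where
  "spectral_projection X A l = borel_calculus X A (indicator {..l})"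

section \<open>Laplace operators and their spectral distributions\<close>

definition markov_op ::
  "('a, 'b) monoid_scheme \<Rightarrow> 'a pmf \<Rightarrow> ('a \<Rightarrow> complex) \<Rightarrow> ('a \<Rightarrow> complex)" where
  "markov_op G \<mu> =
     (\<lambda>f\<in>l2 (carrier G). \<lambda>x. if x \<in> carrier G
        then \<Sum>\<^sub>\<infinity>g\<in>carrier G. f (x \<otimes>\<^bsub>G\<^esub> inv\<^bsub>G\<^esub> g) * complex_of_real (pmf \<mu> g)
        else 0)"

definition laplace_op ::
  "('a, 'b) monoid_scheme \<Rightarrow> 'a pmf \<Rightarrow> ('a \<Rightarrow> complex) \<Rightarrow> ('a \<Rightarrow> complex)" where
  "laplace_op G \<mu> = (\<lambda>f\<in>l2 (carrier G). \<lambda>x. f x - markov_op G \<mu> f x)"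

definition group_trace ::
  "('a, 'b) monoid_scheme \<Rightarrow> (('a \<Rightarrow> complex) \<Rightarrow> ('a \<Rightarrow> complex)) \<Rightarrow> complex" where
  "group_trace G A =
     l2_inner (carrier G) (A (point_mass \<one>\<^bsub>G\<^esub>)) (point_mass \<one>\<^bsub>G\<^esub>)"

text \<open>The trace of a self-adjoint operator is real, so taking the real part loses nothing.\<close>

definition spectral_distribution :: "('a, 'b) monoid_scheme \<Rightarrow> 'a pmf \<Rightarrow> real \<Rightarrow> real" where
  "spectral_distribution G \<mu> l =
     Re (group_trace G (spectral_projection (carrier G) (laplace_op G \<mu>) l))"

section \<open>Dilatational comparison near zero\<close>

definition dil_le :: "(real \<Rightarrow> real) \<Rightarrow> (real \<Rightarrow> real) \<Rightarrow> bool" where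
  "dil_le f g \<longleftrightarrow> (\<exists>D>0. \<exists>\<epsilon>>0. \<forall>l\<in>{0..<\<epsilon>}. f l \<le> g (D * l))"

definition dil_equiv :: "(real \<Rightarrow> real) \<Rightarrow> (real \<Rightarrow> real) \<Rightarrow> bool" where
  "dil_equiv f g \<longleftrightarrow> dil_le f g \<and> dil_le g f"

end

theory Submission
  imports Defs "HOL-Computational_Algebra.Polynomial"
begin

text \<open>
  Let \<open>\<Delta>\<^sub>\<mu>\<close> be the Laplace operator of \<open>\<mu>\<close>. Its quadratic form is \<open>\<langle>\<Delta>\<^sub>\<mu> f, f\<rangle> = 1/2 \<Sum>\<^sub>g \<mu>(g) \<parallel>f \<cdot> g - f\<parallel>\<^sup>2\<close>,
  and \<open>g \<mapsto> \<parallel>f \<cdot> g - f\<parallel>\<close> is a subadditive symmetric function on the group, hence at most the word length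
  times its sum over a generating set. A generating set in the support of \<open>\<nu>\<close> and the second
  moment of \<open>\<mu>\<close> therefore give \<open>\<Delta>\<^sub>\<mu> \<le> C \<Delta>\<^sub>\<nu>\<close>. If \<open>P\<close> and \<open>Q\<close> are the spectral projections of
  \<open>\<Delta>\<^sub>\<nu>\<close> at \<open>\<lambda>\<close> and of \<open>\<Delta>\<^sub>\<mu>\<close> at \<open>C \<lambda>\<close>, then no nonzero vector in the range of \<open>P\<close> is killed by \<open>Q\<close>.
  Instead of a polar decomposition, \<open>tr P \<le> tr Q\<close> is obtained from polynomials: for
  \<open>r\<^sub>n(t) = 1 - (1 - t)\<^sup>n\<close>, which vanishes at \<open>0\<close>, the trace property gives
  \<open>tr r\<^sub>n(PQP) = tr r\<^sub>n(QPQ) \<le> tr Q\<close>, while \<open>r\<^sub>n(PQP)\<close> tends strongly to \<open>P\<close>.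

  The spectral measure of a positive contraction \<open>A\<close> at a unit vector \<open>f\<close> is a weak limit of the
  Bernstein measures with mass \<open>(n choose k) \<langle>A\<^sup>k (1 - A)\<^sup>n\<^sup>-\<^sup>k f, f\<rangle>\<close> at \<open>k / n\<close> (Hausdorff's moment
  problem), and spectral projections are strong limits of polynomials in \<open>A\<close>.
\<close>

section \<open>Moment problems on compact intervals\<close>

lemma falling_ratio_approx:
  assumes "k \<le> n" "m \<le> n"
  shows "\<bar>(real k / real n) ^ m - (\<Prod>i<m. real (k - i) / real (n - i))\<bar> \<le> (real m)\<^sup>2 / real n"
proof -
  \<comment> \<open>For k > i the gap equals i (n - k) / (n (n - i)), which is at most i / n. For
    \<open>k \<le> i\<close> truncated subtraction makes the second fraction 0, and the first is at
    most m / n since k < m. All factors lie in the unit interval, so the products differ by at most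
    the sum of these gaps.\<close>
  have fac: "\<bar>real k / real n - real (k - i) / real (n - i)\<bar> \<le> real m / real n" if "i < m" for i
  proof (cases "k \<le> i")
    case True
    then show ?thesis using that by (simp add: divide_right_mono)
  next
    case False
    have n: "real n > real i" "real k \<le> real n" using False that assms by auto
    have "real k / real n - real (k - i) / real (n - i) = real i * (real n - real k) / (real n * (real n - real i))"
      using n False by (simp add: of_nat_diff field_simps)
    moreover have "real i * (real n - real k) / (real n * (real n - real i)) \<le> real i / real n"
      using n False by (simp add: field_simps mult_left_mono)
    moreover have "0 \<le> real i * (real n - real k) / (real n * (real n - real i))"
      using n by simp
    moreover have "real i / real n \<le> real m / real n" using that by (simp add: divide_right_mono)
    ultimately show ?thesis by (simp only: abs_of_nonneg)
  qed
  have "norm ((\<Prod>i<m. real k / real n) - (\<Prod>i<m. real (k - i) / real (n - i)))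
     \<le> (\<Sum>i<m. norm (real k / real n - real (k - i) / real (n - i)))"
    by (rule norm_prod_diff) (use assms in \<open>auto simp: divide_le_eq_1\<close>)
  also have "\<dots> \<le> (\<Sum>i<m. real m / real n)"
    by (rule sum_mono) (use fac in auto)
  also have "\<dots> = (real m)\<^sup>2 / real n" by (simp add: power2_eq_square)
  finally show ?thesis by simp
qed

text \<open>Iterated absorption k (n choose k) = n (n - 1 choose k - 1): each step uses up one
  factor of the product. For m > k the factor with index k vanishes. This makes the mean of the
  falling ratio under the Bernstein weights exactly computable.\<close>

lemma binomial_falling_ratio:
  assumes "m \<le> n" "k \<le> n"
  shows "real (n choose k) * (\<Prod>i<m. real (k - i) / real (n - i)) =
    (if m \<le> k then real ((n - m) choose (k - m)) else 0)"
  using assms(1)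
proof (induction m)
  case 0
  then show ?case by simp
next
  case (Suc m)
  show ?case
  proof (cases "Suc m \<le> k")
    case True
    have e: "real (k - m) * real ((n - m) choose (k - m)) = real (n - m) * real ((n - Suc m) choose (k - Suc m))"
    proof -
      have "Suc (k - Suc m) = k - m" "n - m - 1 = n - Suc m" using True by auto
      then have "(k - m) * ((n - m) choose (k - m)) = (n - m) * ((n - Suc m) choose (k - Suc m))"
        using binomial_absorption[of "k - Suc m" "n - m"] by simp
      then show ?thesis by (metis of_nat_mult)
    qed
    have "real (n choose k) * (\<Prod>i<Suc m. real (k - i) / real (n - i)) =
       real ((n - m) choose (k - m)) * (real (k - m) / real (n - m))"
      using Suc True by (simp add: mult.assoc[symmetric])
    also have "\<dots> = real ((n - Suc m) choose (k - Suc m))"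
      using e Suc.prems by (simp add: field_simps)
    finally show ?thesis using True by simp
  next
    case False
    then have "m < Suc m \<and> k - m = 0" by simp
    then have "(\<Prod>i<Suc m. real (k - i) / real (n - i)) = 0"
      by simp
    then show ?thesis using False by simp
  qed
qed

text \<open>Unfold the recursion m times; Pascal's rule counts how often each entry occurs. If
  \<open>d k j\<close> is the integral of t^k (1 - t)^j, this is (t + (1 - t))^m = 1 under the
  integral.\<close>

lemma pascal_array_sum:
  fixes d :: "nat \<Rightarrow> nat \<Rightarrow> real"
  assumes "\<And>k j. d k j = d (Suc k) j + d k (Suc j)"
  shows "(\<Sum>i\<le>m. real (m choose i) * d (k + i) (j + (m - i))) = d k j"
proof (induction m arbitrary: k j)
  case 0
  then show ?case by simp
next
  case (Suc m)
  have "(\<Sum>i\<le>Suc m. real (Suc m choose i) * d (k + i) (j + (Suc m - i))) =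
     d k (j + Suc m) + (\<Sum>i\<le>m. real ((m choose i) + (m choose Suc i)) * d (k + Suc i) (j + (m - i)))"
    by (subst sum.atMost_Suc_shift) simp
  also have "\<dots> = (\<Sum>i\<le>m. real (m choose i) * d (Suc k + i) (j + (m - i)))
     + (d k (j + Suc m) + (\<Sum>i\<le>m. real (m choose Suc i) * d (k + Suc i) (j + (m - i))))"
    by (simp add: algebra_simps sum.distrib)
  also have "d k (j + Suc m) + (\<Sum>i\<le>m. real (m choose Suc i) * d (k + Suc i) (j + (m - i)))
     = (\<Sum>i\<le>Suc m. real (m choose i) * d (k + i) (j + (Suc m - i)))"
    by (subst sum.atMost_Suc_shift) simp
  also have "\<dots> = (\<Sum>i\<le>m. real (m choose i) * d (k + i) (Suc j + (m - i)))"
    by (simp add: Suc_diff_le)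
  finally show ?case using Suc.IH assms by metis
qed

text \<open>\<open>d k j\<close> stands for the integral of t^k (1 - t)^j against the measure
  sought. Placing mass \<open>w n k\<close> at k / n gives probability measures on the unit
  interval, and tightness yields a weak limit along a subsequence. The falling ratio has mean
  exactly \<open>d m 0\<close> and differs from (k / n)^m by at most m^2 / n, which identifies the
  moments of the limit.\<close>

lemma hausdorff_moment:
  fixes d :: "nat \<Rightarrow> nat \<Rightarrow> real"
  assumes rec: "\<And>k j. d k j = d (Suc k) j + d k (Suc j)"
    and nonneg: "\<And>k j. 0 \<le> d k j"
    and one: "d 0 0 = 1"
  obtains M where "real_distribution M" "AE t in M. 0 \<le> t \<and> t \<le> 1"
    "\<And>m. (\<integral>t. t ^ m \<partial>M) = d m 0"
proof -
  define w where "w n k = (if k \<le> n then real (n choose k) * d k (n - k) else 0)" for n k :: nat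
  have w_sum: "(\<Sum>k\<le>n. w n k) = 1" for n
    using pascal_array_sum[of d n 0 0, OF rec] one by (simp add: w_def)
  have w0: "0 \<le> w n k" for n k by (simp add: w_def nonneg)
  have w_int: "(\<integral>\<^sup>+ k. ennreal (w n k) \<partial>count_space UNIV) = 1" for n
  proof -
    have "(\<integral>\<^sup>+ k. ennreal (w n k) \<partial>count_space UNIV) = (\<Sum>k\<le>n. ennreal (w n k))"
      by (rule nn_integral_count_space'[where A = "{..n}"]) (auto simp: w_def)
    also have "\<dots> = 1" using w_sum[of n] w0 by (simp add: sum_ennreal)
    finally show ?thesis .
  qed
  define W where "W n = embed_pmf (w n)" for n
  have pmf_W: "pmf (W n) k = w n k" for n k
    unfolding W_def by (rule pmf_embed_pmf) (use w0 w_int in auto)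
  have set_W: "set_pmf (W n) \<subseteq> {..n}" for n
    by (auto simp: set_pmf_eq pmf_W w_def split: if_splits)
  define \<nu> where "\<nu> n = distr (measure_pmf (W n)) borel (\<lambda>k. real k / real n)" for n
  have rd: "real_distribution (\<nu> n)" for n
    unfolding \<nu>_def by (rule prob_space.real_distribution_distr[OF measure_pmf.prob_space_axioms]) simp
  have int: "(\<integral>t. g t \<partial>\<nu> n) = (\<Sum>k\<le>n. w n k * g (real k / real n))"
    if "g \<in> borel_measurable borel" for g :: "real \<Rightarrow> real" and n
    unfolding \<nu>_def using that
    by (subst integral_distr)
       (auto simp: pmf_W set_pmf_eq w_def intro!: integral_measure_pmf[of "{..n}", THEN trans] split: if_splits)
  have ratio01: "0 \<le> real k / real n \<and> real k / real n \<le> 1" if "k \<le> n" for k n :: nat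
    using that by (cases "n = 0") (auto simp: divide_le_eq_1)
  \<comment> \<open>\<open>tight\<close> asks for half-open intervals, so the left end lies below 0
    to catch the mass at 0.\<close>
  have supp: "measure (\<nu> n) {-1<..1} = 1" for n
  proof -
    interpret real_distribution "\<nu> n" by (rule rd)
    have "measure (\<nu> n) {-1<..1} = (\<integral>t. indicator {-1<..1} t \<partial>\<nu> n)" by simp
    also have "\<dots> = (\<Sum>k\<le>n. w n k * indicator {-1<..1} (real k / real n))"
      by (rule int) simp
    also have "\<dots> = (\<Sum>k\<le>n. w n k)"
    proof (rule sum.cong)
      fix k assume "k \<in> {..n}"
      then have "real k / real n \<in> {-1<..1}" using ratio01[of k n] by (auto intro: less_le_trans[of _ 0])
      then show "w n k * indicator {-1<..1} (real k / real n) = w n k" by simp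
    qed simp
    finally show ?thesis using w_sum by simp
  qed
  have "tight \<nu>"
    unfolding tight_def
  proof (intro conjI allI impI rd)
    fix e :: real assume "0 < e"
    then show "\<exists>a b. a < b \<and> (\<forall>n. 1 - e < measure (\<nu> n) {a<..b})"
      by (intro exI[of _ "-1"] exI[of _ 1]) (simp add: supp)
  qed
  then obtain r M where r: "strict_mono r" and M: "real_distribution M" and "weak_conv_m (\<nu> \<circ> id \<circ> r) M"
    using tight_imp_convergent_subsubsequence[of \<nu> id] by (auto simp: strict_mono_id)
  then have wc: "weak_conv_m (\<lambda>n. \<nu> (r n)) M" by (simp add: comp_def)
  interpret M: real_distribution M by (rule M)
  have lim: "(\<lambda>n. \<Sum>k\<le>r n. w (r n) k * g (real k / real (r n))) \<longlonglongrightarrow> (\<integral>t. g t \<partial>M)"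
    if "\<And>x. isCont g x" "\<And>x. \<bar>g x\<bar> \<le> B" for g :: "real \<Rightarrow> real" and B
  proof -
    have "(\<lambda>n. \<integral>t. g t \<partial>\<nu> (r n)) \<longlonglongrightarrow> (\<integral>t. g t \<partial>M)"
      by (rule weak_conv_imp_integral_bdd_continuous_conv[OF rd M wc]) (use that in auto)
    moreover have "g \<in> borel_measurable borel"
      using that(1) by (intro borel_measurable_continuous_onI continuous_at_imp_continuous_on) auto
    ultimately show ?thesis by (simp add: int)
  qed
  \<comment> \<open>A bounded continuous function vanishing exactly on the unit interval. Its
    integral against the weak limit is 0, which confines \<open>M\<close> to that interval.\<close>
  define h where "h t = min 1 (\<bar>t - max 0 (min 1 t)\<bar>)" for t :: real
  have h_cont: "isCont h x" for x
  proof -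
    have "continuous_on UNIV h" unfolding h_def by (intro continuous_intros)
    then show ?thesis by (simp add: continuous_on_eq_continuous_at)
  qed
  have "(\<lambda>n. \<Sum>k\<le>r n. w (r n) k * h (real k / real (r n))) \<longlonglongrightarrow> (\<integral>t. h t \<partial>M)"
    by (rule lim[of _ 1]) (auto simp: h_cont, auto simp: h_def)
  moreover have "(\<Sum>k\<le>n. w n k * h (real k / real n)) = 0" for n
  proof (rule sum.neutral, rule ballI)
    fix k assume "k \<in> {..n}"
    then have "h (real k / real n) = 0" using ratio01[of k n] by (simp add: h_def)
    then show "w n k * h (real k / real n) = 0" by simp
  qed
  ultimately have "(\<integral>t. h t \<partial>M) = 0" by (simp add: LIMSEQ_const_iff)
  moreover have h_meas: "h \<in> borel_measurable borel"
    using h_cont by (intro borel_measurable_continuous_onI continuous_at_imp_continuous_on) auto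
  have "integrable M h"
    by (rule M.integrable_const_bound[of _ 1]) (use h_meas in \<open>auto simp: h_def\<close>)
  ultimately have "AE t in M. h t = 0"
    by (subst (asm) integral_nonneg_eq_0_iff_AE) (auto simp: h_def)
  then have AE: "AE t in M. 0 \<le> t \<and> t \<le> 1"
    by (rule AE_mp) (auto simp: h_def max_def min_def split: if_splits)
  have mom: "(\<integral>t. t ^ m \<partial>M) = d m 0" for m
  proof -
    \<comment> \<open>Powers are unbounded on the line; the truncated power is bounded and
      continuous, hence a legitimate test function for weak convergence, and agrees with t^m on the
      support.\<close>
    define g where "g t = (max 0 (min 1 t)) ^ m" for t :: real
    have g_cont: "isCont g x" for x
    proof -
      have "continuous_on UNIV g" unfolding g_def by (intro continuous_intros)
      then show ?thesis by (simp add: continuous_on_eq_continuous_at)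
    qed
    have g_meas: "g \<in> borel_measurable borel"
      using g_cont by (intro borel_measurable_continuous_onI continuous_at_imp_continuous_on) auto
    have "(\<integral>t. t ^ m \<partial>M) = (\<integral>t. g t \<partial>M)"
      by (rule integral_cong_AE) (use AE g_meas in \<open>auto simp: g_def\<close>)
    have l1: "(\<lambda>n. \<Sum>k\<le>r n. w (r n) k * g (real k / real (r n))) \<longlonglongrightarrow> (\<integral>t. g t \<partial>M)"
      by (rule lim[of _ 1]) (auto simp: g_cont, auto simp: g_def abs_le_iff power_le_one_iff power_le_one)
    have bound: "\<bar>(\<Sum>k\<le>n. w n k * g (real k / real n)) - d m 0\<bar> \<le> (real m)\<^sup>2 / real n" if mn: "m \<le> n" for n
    proof -
      have "(\<Sum>k\<le>n. w n k * (\<Prod>i<m. real (k - i) / real (n - i))) =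
        (\<Sum>k\<le>n. if m \<le> k then real ((n - m) choose (k - m)) * d k (n - k) else 0)"
      proof (rule sum.cong)
        fix k assume "k \<in> {..n}"
        then have "w n k * (\<Prod>i<m. real (k - i) / real (n - i)) =
            d k (n - k) * (real (n choose k) * (\<Prod>i<m. real (k - i) / real (n - i)))"
          by (simp only: w_def atMost_iff if_True mult_ac)
        also have "\<dots> = d k (n - k) * (if m \<le> k then real ((n - m) choose (k - m)) else 0)"
          using \<open>k \<in> {..n}\<close> by (subst binomial_falling_ratio[OF mn]) auto
        finally show "w n k * (\<Prod>i<m. real (k - i) / real (n - i)) =
            (if m \<le> k then real ((n - m) choose (k - m)) * d k (n - k) else 0)" by simp
      qed simp
      also have "\<dots> = (\<Sum>k\<in>{m..n}. real ((n - m) choose (k - m)) * d k (n - k))"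
        by (rule sum.mono_neutral_cong_right) auto
      also have "\<dots> = (\<Sum>i\<le>n - m. real ((n - m) choose i) * d (m + i) (0 + ((n - m) - i)))"
        by (rule sum.reindex_bij_witness[of _ "\<lambda>i. m + i" "\<lambda>k. k - m"]) (use mn in auto)
      also have "\<dots> = d m 0" by (rule pascal_array_sum) (rule rec)
      finally have e: "d m 0 = (\<Sum>k\<le>n. w n k * (\<Prod>i<m. real (k - i) / real (n - i)))" by simp
      have "\<bar>(\<Sum>k\<le>n. w n k * g (real k / real n)) - d m 0\<bar> =
         \<bar>\<Sum>k\<le>n. w n k * ((real k / real n) ^ m - (\<Prod>i<m. real (k - i) / real (n - i)))\<bar>"
        unfolding e sum_subtractf[symmetric] right_diff_distrib
        by (intro arg_cong[of _ _ abs] sum.cong) (use ratio01 in \<open>auto simp: g_def\<close>)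
      also have "\<dots> \<le> (\<Sum>k\<le>n. \<bar>w n k * ((real k / real n) ^ m - (\<Prod>i<m. real (k - i) / real (n - i)))\<bar>)"
        by (rule sum_abs)
      also have "\<dots> \<le> (\<Sum>k\<le>n. w n k * ((real m)\<^sup>2 / real n))"
      proof (rule sum_mono)
        fix k assume "k \<in> {..n}"
        then have "w n k * \<bar>(real k / real n) ^ m - (\<Prod>i<m. real (k - i) / real (n - i))\<bar> \<le> w n k * ((real m)\<^sup>2 / real n)"
          by (intro mult_left_mono w0 falling_ratio_approx mn) simp
        then show "\<bar>w n k * ((real k / real n) ^ m - (\<Prod>i<m. real (k - i) / real (n - i)))\<bar> \<le> w n k * ((real m)\<^sup>2 / real n)"
          by (simp only: abs_mult abs_of_nonneg[OF w0])
      qed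
      also have "\<dots> = (real m)\<^sup>2 / real n"
        unfolding sum_distrib_right[symmetric] w_sum by simp
      finally show ?thesis .
    qed
    have "(\<lambda>n. (\<Sum>k\<le>n. w n k * g (real k / real n)) - d m 0) \<longlonglongrightarrow> 0"
    proof (rule Lim_null_comparison)
      show "\<forall>\<^sub>F n in sequentially. norm ((\<Sum>k\<le>n. w n k * g (real k / real n)) - d m 0) \<le> (real m)\<^sup>2 / real n"
        using bound by (auto simp: eventually_sequentially)
      show "(\<lambda>n. (real m)\<^sup>2 / real n) \<longlonglongrightarrow> 0"
        by (rule lim_const_over_n)
    qed
    then have "(\<lambda>n. (\<Sum>k\<le>n. w n k * g (real k / real n))) \<longlonglongrightarrow> d m 0"
      by (simp add: LIM_zero_iff)
    from LIMSEQ_subseq_LIMSEQ[OF this r] l1 have "(\<integral>t. g t \<partial>M) = d m 0"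
      by (intro LIMSEQ_unique) (auto simp: comp_def)
    with \<open>(\<integral>t. t ^ m \<partial>M) = (\<integral>t. g t \<partial>M)\<close> show ?thesis by simp
  qed
  from that[OF M AE mom] show ?thesis .
qed

section \<open>Polynomial approximation of half-lines, and determinacy by moments\<close>

lemma poly_approx_indicator_atMost:
  fixes a b l :: real
  obtains p :: "nat \<Rightarrow> real poly" where
    "\<And>n t. a \<le> t \<Longrightarrow> t \<le> b \<Longrightarrow> \<bar>poly (p n) t\<bar> \<le> 2"
    "\<And>t. a \<le> t \<Longrightarrow> t \<le> b \<Longrightarrow> (\<lambda>n. poly (p n) t) \<longlonglongrightarrow> indicator {..l} t"
proof -
  \<comment> \<open>For n > 0 a continuous ramp from 1 at l down to 0 at l + 1 / n. The ramps tend
    pointwise to the indicator of the closed half-line and stay in the unit interval, so polynomials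
    within 1 / (n + 1) of them are bounded by 2 uniformly in n, as dominated convergence will
    require.\<close>
  define g where "g n t = max 0 (min 1 (1 - real n * (t - l)))" for n :: nat and t :: real
  have "\<exists>p :: real poly. \<forall>t\<in>{a..b}. \<bar>g n t - poly p t\<bar> < 1 / real (Suc n)" for n
  proof -
    have "continuous_on {a..b} (g n)" unfolding g_def by (intro continuous_intros)
    then obtain q where q: "real_polynomial_function q" "\<And>x. x \<in> {a..b} \<Longrightarrow> \<bar>g n x - q x\<bar> < 1 / real (Suc n)"
      using Stone_Weierstrass_real_polynomial_function[of "{a..b}" "g n" "1 / real (Suc n)"] by auto
    then obtain c m where "q = (\<lambda>x. \<Sum>i\<le>m. c i * x ^ i)"
      using real_polynomial_function_iff_sum by metis
    then have "q x = poly (\<Sum>i\<le>m. monom (c i) i) x" for x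
      by (simp add: poly_sum poly_monom)
    with q show ?thesis by metis
  qed
  then obtain p :: "nat \<Rightarrow> real poly" where p: "\<And>n t. t \<in> {a..b} \<Longrightarrow> \<bar>g n t - poly (p n) t\<bar> < 1 / real (Suc n)"
    by metis
  show ?thesis
  proof
    fix n t assume t: "a \<le> t" "t \<le> b"
    have "1 / real (Suc n) \<le> 1" by simp
    moreover have "\<bar>g n t\<bar> \<le> 1" by (auto simp: g_def)
    ultimately show "\<bar>poly (p n) t\<bar> \<le> 2" using p[of t n] t by (simp only: atLeastAtMost_iff) argo
  next
    fix t assume t: "a \<le> t" "t \<le> b"
    have "(\<lambda>n. g n t - poly (p n) t) \<longlonglongrightarrow> 0"
    proof (rule Lim_null_comparison)
      show "\<forall>\<^sub>F n in sequentially. norm (g n t - poly (p n) t) \<le> 1 / real (Suc n)"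
        using p[of t] t by (intro always_eventually allI less_imp_le) (simp del: of_nat_Suc)
      show "(\<lambda>n. 1 / real (Suc n)) \<longlonglongrightarrow> 0"
        using LIMSEQ_inverse_real_of_nat by (simp add: inverse_eq_divide)
    qed
    moreover have "(\<lambda>n. g n t) \<longlonglongrightarrow> indicator {..l} t"
    proof (cases "t \<le> l")
      case True
      have "g n t = 1" for n
      proof -
        have "real n * (t - l) \<le> 0" using True by (simp add: mult_nonneg_nonpos)
        then show ?thesis by (simp add: g_def)
      qed
      then show ?thesis using True by simp
    next
      case False
      obtain N where N: "real N * (t - l) \<ge> 1"
        using False reals_Archimedean3[of "t - l"] by (metis diff_gt_0_iff_gt less_eq_real_def not_le)
      have "g n t = 0" if "N \<le> n" for n
      proof -
        have "real N * (t - l) \<le> real n * (t - l)" using that False by (intro mult_right_mono) auto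
        then show ?thesis using N by (simp add: g_def)
      qed
      then have "\<forall>\<^sub>F n in sequentially. g n t = 0" by (auto simp: eventually_sequentially)
      then show ?thesis using False by (simp add: tendsto_eventually)
    qed
    ultimately have "(\<lambda>n. g n t - (g n t - poly (p n) t)) \<longlonglongrightarrow> indicator {..l} t - 0"
      by (intro tendsto_diff)
    then show "(\<lambda>n. poly (p n) t) \<longlonglongrightarrow> indicator {..l} t" by simp
  qed
qed

lemma integrable_poly_compact_support:
  fixes M :: "real measure" and p :: "real poly"
  assumes "finite_measure M" "sets M = sets borel" "AE t in M. a \<le> t \<and> t \<le> b"
  shows "integrable M (poly p)"
proof -
  interpret finite_measure M by fact
  have "compact (poly p ` {a..b})"
    by (intro compact_continuous_image continuous_intros) auto
  then obtain B where B: "\<And>t. t \<in> {a..b} \<Longrightarrow> norm (poly p t) \<le> B"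
    using compact_imp_bounded[of "poly p ` {a..b}"] unfolding bounded_iff by blast
  have "poly p \<in> borel_measurable borel" by (intro borel_measurable_continuous_onI continuous_intros)
  then have "poly p \<in> borel_measurable M" using assms(2) by (simp cong: measurable_cong_sets)
  then show ?thesis
    by (intro integrable_const_bound[of _ B]) (use assms(3) B in auto)
qed

text \<open>The extra factor \<open>q\<close> serves two uses: \<open>q = 1\<close> gives the
  measure of the half-line, and \<open>q = [:0, 1:]\<close> the quadratic form cut off at l.\<close>

lemma integral_poly_tendsto_indicator:
  fixes M :: "real measure" and p :: "nat \<Rightarrow> real poly" and q :: "real poly"
  assumes M: "finite_measure M" "sets M = sets borel" "AE t in M. a \<le> t \<and> t \<le> b"
    and bnd: "\<And>n t. a \<le> t \<Longrightarrow> t \<le> b \<Longrightarrow> \<bar>poly (p n) t\<bar> \<le> B"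
    and lim: "\<And>t. a \<le> t \<Longrightarrow> t \<le> b \<Longrightarrow> (\<lambda>n. poly (p n) t) \<longlonglongrightarrow> indicator {..l} t"
  shows "(\<lambda>n. \<integral>t. poly q t * poly (p n) t \<partial>M) \<longlonglongrightarrow> (\<integral>t. poly q t * indicator {..l} t \<partial>M)"
proof (rule integral_dominated_convergence[where w = "\<lambda>t. \<bar>poly q t\<bar> * B"])
  have m: "poly r \<in> borel_measurable M" for r :: "real poly"
    using integrable_poly_compact_support[OF M] by blast
  show "(\<lambda>t. poly q t * indicator {..l} t) \<in> borel_measurable M"
    using m[of q] M(2) by (intro borel_measurable_times borel_measurable_indicator) auto
  show "(\<lambda>t. poly q t * poly (p n) t) \<in> borel_measurable M" for n
    using m by (intro borel_measurable_times) auto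
  show "integrable M (\<lambda>t. \<bar>poly q t\<bar> * B)"
    using integrable_poly_compact_support[OF M] by auto
  show "AE t in M. (\<lambda>n. poly q t * poly (p n) t) \<longlonglongrightarrow> poly q t * indicator {..l} t"
    using M(3) by eventually_elim (auto intro!: tendsto_mult lim)
  show "AE t in M. norm (poly q t * poly (p n) t) \<le> \<bar>poly q t\<bar> * B" for n
    using M(3) by eventually_elim (auto simp: abs_mult intro!: mult_left_mono bnd)
qed

lemma integral_poly_eq_moments:
  fixes M :: "real measure" and p :: "real poly"
  assumes M: "finite_measure M" "sets M = sets borel" "AE t in M. a \<le> t \<and> t \<le> b"
  shows "(\<integral>t. poly p t \<partial>M) = (\<Sum>i\<le>degree p. coeff p i * (\<integral>t. t ^ i \<partial>M))"
proof -
  have "integrable M (\<lambda>t. t ^ i)" for i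
    using integrable_poly_compact_support[OF M, of "monom 1 i"] by (simp add: poly_monom[abs_def])
  then show ?thesis by (simp add: poly_altdef)
qed

text \<open>Integrals of polynomials depend only on the moments, and along the approximating
  sequence they tend to the values of the distribution functions. This uniqueness makes the
  description in \<open>spectral_measure\<close> well defined.\<close>

lemma compact_measure_eq_by_moments:
  fixes M N :: "real measure"
  assumes M: "finite_measure M" "sets M = sets borel" "AE t in M. a \<le> t \<and> t \<le> b"
    and N: "finite_measure N" "sets N = sets borel" "AE t in N. a' \<le> t \<and> t \<le> b'"
    and eq: "\<And>n::nat. (\<integral>t. t ^ n \<partial>M) = (\<integral>t. t ^ n \<partial>N)"
  shows "M = N"
proof (rule cdf_unique')
  show "finite_borel_measure M" "finite_borel_measure N"
    using M N by (auto simp: finite_borel_measure_def finite_borel_measure_axioms_def)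
  show "cdf M = cdf N"
  proof
    fix l
    define A where "A = min a a'" define B where "B = max b b'"
    have M': "AE t in M. A \<le> t \<and> t \<le> B" using M(3) by eventually_elim (auto simp: A_def B_def)
    have N': "AE t in N. A \<le> t \<and> t \<le> B" using N(3) by eventually_elim (auto simp: A_def B_def)
    obtain p :: "nat \<Rightarrow> real poly" where p:
      "\<And>n t. A \<le> t \<Longrightarrow> t \<le> B \<Longrightarrow> \<bar>poly (p n) t\<bar> \<le> 2"
      "\<And>t. A \<le> t \<Longrightarrow> t \<le> B \<Longrightarrow> (\<lambda>n. poly (p n) t) \<longlonglongrightarrow> indicator {..l} t"
      by (rule poly_approx_indicator_atMost[of A B l]) blast
    have "(\<lambda>n. \<integral>t. poly (p n) t \<partial>M) \<longlonglongrightarrow> (\<integral>t. indicator {..l} t \<partial>M)"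
      using integral_poly_tendsto_indicator[OF M(1,2) M' p, of 1] by simp
    moreover have "(\<lambda>n. \<integral>t. poly (p n) t \<partial>N) \<longlonglongrightarrow> (\<integral>t. indicator {..l} t \<partial>N)"
      using integral_poly_tendsto_indicator[OF N(1,2) N' p, of 1] by simp
    moreover have "(\<integral>t. poly (p n) t \<partial>N) = (\<integral>t. poly (p n) t \<partial>M)" for n
      by (simp add: integral_poly_eq_moments[OF M] integral_poly_eq_moments[OF N] eq)
    ultimately have "(\<integral>t. indicator {..l} t \<partial>M) = (\<integral>t. indicator {..l} t \<partial>N :: real)"
      using LIMSEQ_unique by auto
    then show "cdf M l = cdf N l"
      using M(2) N(2) by (simp add: cdf_def sets_eq_imp_space_eq[OF M(2)] sets_eq_imp_space_eq[OF N(2)])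
  qed
qed

section \<open>Symmetric operators on real Hilbert spaces\<close>

text \<open>Real scalars suffice here: the complex Hilbert space is later viewed as a real one with
  the real part of its inner product, and complex linearity is expressed as commutation with
  multiplication by i.\<close>

definition symmetric_op :: "('h::real_inner \<Rightarrow> 'h) \<Rightarrow> bool" where
  "symmetric_op A \<longleftrightarrow> bounded_linear A \<and> (\<forall>f g. A f \<bullet> g = f \<bullet> A g)"

lemma symmetric_opD:
  assumes "symmetric_op A"
  shows "bounded_linear A" "linear A" "A f \<bullet> g = f \<bullet> A g"
  using assms by (auto simp: symmetric_op_def bounded_linear.linear)

lemma bounded_linear_funpow: "bounded_linear A \<Longrightarrow> bounded_linear (A ^^ n)"
  for A :: "'h::real_normed_vector \<Rightarrow> 'h"
proof (induction n)
  case 0 then show ?case by (simp add: id_def bounded_linear_ident)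
next
  case (Suc n)
  then show ?case using bounded_linear_compose[of A "A ^^ n"] by (simp add: comp_def)
qed

lemma symmetric_op_funpow: "symmetric_op A \<Longrightarrow> symmetric_op (A ^^ n)"
proof (induction n)
  case 0 then show ?case by (simp add: symmetric_op_def id_def bounded_linear_ident)
next
  case (Suc n)
  then have "(A ^^ n) (A f) = A ((A ^^ n) f)" for f by (simp add: funpow_swap1)
  with Suc show ?case
    using bounded_linear_compose[of A "A ^^ n"] by (auto simp: symmetric_op_def comp_def)
qed

section \<open>Polynomial calculus of a bounded operator\<close>

definition poly_op :: "('h::real_normed_vector \<Rightarrow> 'h) \<Rightarrow> real poly \<Rightarrow> 'h \<Rightarrow> 'h" where
  "poly_op A p f = (\<Sum>i\<le>degree p. coeff p i *\<^sub>R (A ^^ i) f)"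

lemma poly_op_eq_sum:
  assumes "degree p \<le> n"
  shows "poly_op A p f = (\<Sum>i\<le>n. coeff p i *\<^sub>R (A ^^ i) f)"
  unfolding poly_op_def
  by (rule sum.mono_neutral_left) (use assms in \<open>auto simp: coeff_eq_0\<close>)

lemma poly_op_0 [simp]: "poly_op A 0 f = 0"
  by (simp add: poly_op_def)

lemma poly_op_1 [simp]: "poly_op A 1 f = f"
  by (simp add: poly_op_def)

lemma poly_op_add: "poly_op A (p + q) f = poly_op A p f + poly_op A q f"
proof -
  define n where "n = max (degree p) (degree q)"
  show ?thesis
    using poly_op_eq_sum[of p n A f] poly_op_eq_sum[of q n A f]
      poly_op_eq_sum[of "p + q" n A f] degree_add_le_max[of p q]
    by (simp add: n_def scaleR_add_left sum.distrib)
qed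

lemma poly_op_smult: "poly_op A (smult c p) f = c *\<^sub>R poly_op A p f"
  using poly_op_eq_sum[of "smult c p" "degree p" A f]
  by (simp add: poly_op_def scaleR_sum_right)

lemma poly_op_diff: "poly_op A (p - q) f = poly_op A p f - poly_op A q f"
  using poly_op_add[of A p "smult (-1) q" f] poly_op_smult[of A "-1" q f] by simp

lemma poly_op_pCons:
  assumes "linear A"
  shows "poly_op A (pCons a p) f = a *\<^sub>R f + A (poly_op A p f)"
proof -
  have "poly_op A (pCons a p) f = (\<Sum>i\<le>Suc (degree p). coeff (pCons a p) i *\<^sub>R (A ^^ i) f)"
    by (rule poly_op_eq_sum) (rule degree_pCons_le)
  also have "\<dots> = a *\<^sub>R f + (\<Sum>i\<le>degree p. coeff p i *\<^sub>R A ((A ^^ i) f))"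
    by (subst sum.atMost_Suc_shift) simp
  also have "(\<Sum>i\<le>degree p. coeff p i *\<^sub>R A ((A ^^ i) f)) = A (poly_op A p f)"
    using assms by (simp add: poly_op_def linear_sum linear_scale)
  finally show ?thesis .
qed

lemma bounded_linear_poly_op: "bounded_linear A \<Longrightarrow> bounded_linear (poly_op A p)"
  unfolding poly_op_def[abs_def]
  by (intro bounded_linear_sum bounded_linear_const_scaleR bounded_linear_funpow)

lemma poly_op_mult:
  assumes "bounded_linear A"
  shows "poly_op A (p * q) f = poly_op A p (poly_op A q f)"
proof (induction p)
  case 0
  then show ?case by simp
next
  case (pCons a p)
  have "linear A" using assms by (rule bounded_linear.linear)
  with pCons show ?case by (simp add: poly_op_add poly_op_smult poly_op_pCons)
qed

lemma poly_op_commute: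
  assumes "linear B" "\<And>f. B (A f) = A (B f)"
  shows "B (poly_op A p f) = poly_op A p (B f)"
proof -
  have "B ((A ^^ n) f) = (A ^^ n) (B f)" for n by (induction n) (auto simp: assms(2))
  then show ?thesis using assms(1) by (simp add: poly_op_def linear_sum linear_scale)
qed

lemma symmetric_op_poly_op:
  assumes "symmetric_op A"
  shows "symmetric_op (poly_op A p)"
  unfolding symmetric_op_def
proof (intro conjI allI)
  show "bounded_linear (poly_op A p)"
    by (intro bounded_linear_poly_op symmetric_opD assms)
  fix f g
  show "poly_op A p f \<bullet> g = f \<bullet> poly_op A p g"
    using symmetric_opD(3)[OF symmetric_op_funpow[OF assms]]
    by (simp add: poly_op_def inner_sum_left inner_sum_right)
qed

lemma poly_op_X_power:
  assumes "bounded_linear A"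
  shows "poly_op A ([:0, 1:] ^ k) f = (A ^^ k) f"
  using assms bounded_linear.linear[OF assms]
  by (induction k) (simp_all add: poly_op_mult poly_op_pCons linear_0)

text \<open>Half of each exponent goes into a factor \<open>q\<close> on either side, and the
  self-adjoint operator of \<open>q\<close> moves across the inner product. Only exponents 0 and 1
  remain in the middle, so positivity follows without square roots of operators.\<close>

lemma positive_contraction_power_inner_nonneg:
  assumes A: "symmetric_op A" and pos: "\<And>f. 0 \<le> A f \<bullet> f" and le: "\<And>f. A f \<bullet> f \<le> f \<bullet> f"
  shows "0 \<le> poly_op A ([:0, 1:] ^ k * [:1, - 1:] ^ j) f \<bullet> f"
proof -
  note lin = symmetric_opD(1,2)[OF A]
  let ?X = "[:0, 1:] :: real poly" and ?Y = "[:1, - 1:] :: real poly"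
  have X: "poly_op A ?X g = A g" and Y: "poly_op A ?Y g = g - A g" for g
    using lin by (simp_all add: poly_op_pCons linear_diff linear_0 linear_neg)
  have square: "poly_op A (q * r * q) g \<bullet> g = poly_op A r (poly_op A q g) \<bullet> poly_op A q g" for q r g
    using symmetric_opD(3)[OF symmetric_op_poly_op[OF A]] lin by (simp add: poly_op_mult)
  have sqX: "0 \<le> poly_op A (q * ?X * q) g \<bullet> g" and sqY: "0 \<le> poly_op A (q * ?Y * q) g \<bullet> g" for q g
    unfolding square X Y using pos le by (auto simp: inner_diff_left)
  define q where "q = ?X ^ (k div 2) * ?Y ^ (j div 2)"
  have split: "z ^ n = z ^ (n div 2) * z ^ (n mod 2) * z ^ (n div 2)" for n and z :: "real poly"
  proof -
    have "n = n div 2 + n mod 2 + n div 2" by presburger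
    then show ?thesis by (metis power_add)
  qed
  have e: "?X ^ k * ?Y ^ j = q * (?X ^ (k mod 2) * ?Y ^ (j mod 2)) * q"
    by (subst split[of ?X k], subst split[of ?Y j]) (simp only: q_def mult_ac)
  consider "k mod 2 = 0" "j mod 2 = 0" | "k mod 2 = 1" "j mod 2 = 0" | "k mod 2 = 0" "j mod 2 = 1"
    | "k mod 2 = 1" "j mod 2 = 1" by fastforce
  then show ?thesis
  proof cases
    case 1
    then show ?thesis unfolding e square by simp
  next
    case 2
    then show ?thesis unfolding e using sqX by simp
  next
    case 3
    then show ?thesis unfolding e using sqY by simp
  next
    case 4
    \<comment> \<open>\<open>x (1 - x) = (1 - x) x (1 - x) + x (1 - x) x\<close>\<close>
    have "q * (?X * ?Y) * q = (q * ?Y) * ?X * (q * ?Y) + (q * ?X) * ?Y * (q * ?X)"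
    proof -
      have "?X * ?Y = ?Y * ?X * ?Y + ?X * ?Y * ?X" by simp
      then have "q * (?X * ?Y) * q = q * (?Y * ?X * ?Y + ?X * ?Y * ?X) * q" by (simp only:)
      then show ?thesis by (simp only: distrib_left distrib_right mult_ac)
    qed
    then have "?X ^ k * ?Y ^ j = (q * ?Y) * ?X * (q * ?Y) + (q * ?X) * ?Y * (q * ?X)"
      unfolding e 4 power_one_right .
    then show ?thesis
      using sqX[of "q * ?Y" f] sqY[of "q * ?X" f] by (simp only: poly_op_add inner_add_left)
  qed
qed

text \<open>Put d k j = <A^k (1 - A)^j f, f>. The identity A + (1 - A) = 1 is the recursion of
  Hausdorff's array, and its nonnegativity is
  \<open>positive_contraction_power_inner_nonneg\<close>.\<close>

lemma spectral_measure_exists_contraction: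
  assumes A: "symmetric_op A" and pos: "\<And>f. 0 \<le> A f \<bullet> f" and le: "\<And>f. A f \<bullet> f \<le> f \<bullet> f"
    and f: "norm f = 1"
  shows "\<exists>M. real_distribution M \<and> (AE t in M. 0 \<le> t \<and> t \<le> 1) \<and>
    (\<forall>n. (A ^^ n) f \<bullet> f = (\<integral>t. t ^ n \<partial>M))"
proof -
  define d where "d k j = poly_op A ([:0, 1:] ^ k * [:1, - 1:] ^ j) f \<bullet> f" for k j
  note lin = symmetric_opD(1,2)[OF A]
  have rec: "d k j = d (Suc k) j + d k (Suc j)" for k j
  proof -
    have "[:0, 1:] ^ k * [:1, - 1:] ^ j =
      [:0, 1:] ^ Suc k * [:1, - 1:] ^ j + [:0, 1:] ^ k * [:1, - 1 :: real:] ^ Suc j"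
    proof -
      have "[:0, 1:] + [:1, - 1:] = (1 :: real poly)" by (simp add: one_pCons)
      then have "([:0, 1:] + [:1, - 1:]) * ([:0, 1:] ^ k * [:1, - 1 :: real:] ^ j) =
         [:0, 1:] ^ k * [:1, - 1:] ^ j" by simp
      then show ?thesis unfolding distrib_right by (simp only: power_Suc mult_ac)
    qed
    then show ?thesis by (simp only: d_def poly_op_add inner_add_left)
  qed
  have "0 \<le> d k j" for k j
    unfolding d_def by (rule positive_contraction_power_inner_nonneg[OF A pos le])
  moreover have "d 0 0 = 1" using f by (simp add: d_def dot_square_norm)
  moreover have "d n 0 = (A ^^ n) f \<bullet> f" for n by (simp add: d_def poly_op_X_power lin)
  ultimately show ?thesis
    using hausdorff_moment[of d, OF rec] by metis
qed

section \<open>Spectral measures of positive bounded operators\<close>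

definition spectral_measure_of :: "('h::real_inner \<Rightarrow> 'h) \<Rightarrow> 'h \<Rightarrow> real \<Rightarrow> real measure \<Rightarrow> bool" where
  "spectral_measure_of A f c M \<longleftrightarrow> finite_measure M \<and> sets M = sets borel \<and>
     (AE t in M. 0 \<le> t \<and> t \<le> c) \<and> (\<forall>n. (A ^^ n) f \<bullet> f = (\<integral>t. t ^ n \<partial>M))"

lemma funpow_scaleR:
  fixes A :: "'h::real_vector \<Rightarrow> 'h"
  assumes "linear A"
  shows "((\<lambda>g. a *\<^sub>R A g) ^^ n) f = a ^ n *\<^sub>R (A ^^ n) f"
  by (induction n) (simp_all add: linear_scale[OF assms])

lemma linear_funpow: "linear A \<Longrightarrow> linear (A ^^ n)"
  for A :: "'h::real_vector \<Rightarrow> 'h"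
  by (induction n) (auto simp: linear_compose linear_id simp del: id_apply)

text \<open>The contraction A / c at the unit vector f / |f| has a measure on the unit interval;
  stretch it by c and multiply its mass by |f|^2. The zero vector cannot be normalised and gets the
  null measure.\<close>

lemma spectral_measure_of_exists:
  assumes A: "symmetric_op A" and c: "c > 0"
    and pos: "\<And>f. 0 \<le> A f \<bullet> f" and le: "\<And>f. A f \<bullet> f \<le> c * (f \<bullet> f)"
  shows "\<exists>M. spectral_measure_of A f c M"
proof (cases "f = 0")
  case True
  have "(A ^^ n) 0 = 0" for n
    using linear_funpow[OF symmetric_opD(2)[OF A]] by (rule linear_0)
  then show ?thesis
    using True by (intro exI[of _ "null_measure borel"])
      (auto simp: spectral_measure_of_def AE_iff_null intro!: finite_measureI)
next
  case False
  define B where "B = (\<lambda>g. (1 / c) *\<^sub>R A g)"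
  define u where "u = (1 / norm f) *\<^sub>R f"
  have B: "symmetric_op B"
    using A by (auto simp: symmetric_op_def B_def intro: bounded_linear_const_scaleR)
  have "norm u = 1" using False by (simp add: u_def)
  moreover have "0 \<le> B g \<bullet> g" "B g \<bullet> g \<le> g \<bullet> g" for g
    using pos[of g] le[of g] c by (auto simp: B_def field_simps)
  ultimately obtain N where N: "real_distribution N" "AE t in N. 0 \<le> t \<and> t \<le> 1"
    "\<And>n. (B ^^ n) u \<bullet> u = (\<integral>t. t ^ n \<partial>N)"
    using spectral_measure_exists_contraction[OF B] by metis
  interpret N: real_distribution N by (rule N)
  define s where "s = (norm f)\<^sup>2"
  define M where "M = density (distr N borel (\<lambda>t. c * t)) (\<lambda>_. ennreal s)"
  have s: "s > 0" using False by (simp add: s_def)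
  have "finite_measure M"
    by (rule finite_measureI)
       (simp add: M_def emeasure_density_const emeasure_distr N.emeasure_space_1 ennreal_mult_eq_top_iff)
  moreover have "sets M = sets borel" by (simp add: M_def)
  moreover have "AE t in M. 0 \<le> t \<and> t \<le> c"
  proof -
    have "AE t in distr N borel (\<lambda>t. c * t). 0 \<le> t \<and> t \<le> c"
      using N(2) c by (subst AE_distr_iff) (auto elim!: eventually_mono)
    then show ?thesis unfolding M_def
      by (subst AE_density) (simp, erule eventually_mono, simp)
  qed
  moreover have "(A ^^ n) f \<bullet> f = (\<integral>t. t ^ n \<partial>M)" for n
  proof -
    have "(\<integral>t. t ^ n \<partial>M) = s * (\<integral>t. (c * t) ^ n \<partial>N)"
      using s by (simp add: M_def integral_density integral_distr)
    also have "\<dots> = s * c ^ n * ((B ^^ n) u \<bullet> u)"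
      by (simp add: power_mult_distrib N(3))
    also have "(B ^^ n) u \<bullet> u = (1 / c) ^ n * (1 / s) * ((A ^^ n) f \<bullet> f)"
      unfolding B_def funpow_scaleR[OF symmetric_opD(2)[OF A]] u_def
      by (simp add: linear_scale[OF linear_funpow[OF symmetric_opD(2)[OF A]]] s_def power2_eq_square)
    also have "s * c ^ n * ((1 / c) ^ n * (1 / s) * ((A ^^ n) f \<bullet> f)) = (A ^^ n) f \<bullet> f"
      using s c by (simp add: field_simps)
    finally show ?thesis by simp
  qed
  ultimately show ?thesis by (auto simp: spectral_measure_of_def)
qed

lemma poly_op_inner_eq_integral:
  assumes "spectral_measure_of A f c M"
  shows "poly_op A p f \<bullet> f = (\<integral>t. poly p t \<partial>M)"
  using assms integral_poly_eq_moments[of M 0 c p]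
  by (simp add: spectral_measure_of_def poly_op_def inner_sum_left)

lemma measure_space_spectral_measure:
  assumes "spectral_measure_of A f c M"
  shows "measure M UNIV = f \<bullet> f"
proof -
  have "space M = UNIV" using assms by (metis sets_eq_imp_space_eq space_borel spectral_measure_of_def)
  then show ?thesis
    using assms[unfolded spectral_measure_of_def] by (auto dest!: spec[of _ 0])
qed

section \<open>Orthogonal projections and spectral projections\<close>

definition orth_projection :: "('h::real_inner \<Rightarrow> 'h) \<Rightarrow> bool" where
  "orth_projection P \<longleftrightarrow> symmetric_op P \<and> (\<forall>f. P (P f) = P f)"

text \<open>Apply the hypothesis at f + D f: both cross terms are |D f|^2.\<close>

lemma symmetric_op_zeroI:
  assumes "symmetric_op D" "\<And>f. D f \<bullet> f = 0"
  shows "D f = 0"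
proof -
  have "D (f + D f) \<bullet> (f + D f) = 0" "D f \<bullet> f = 0" "D (D f) \<bullet> D f = 0" using assms(2) by auto
  moreover have "D (D f) \<bullet> f = D f \<bullet> D f" by (rule symmetric_opD(3)[OF assms(1)])
  ultimately have "2 * (D f \<bullet> D f) = 0"
    using symmetric_opD(2)[OF assms(1)] by (simp add: linear_add inner_add_left inner_add_right)
  then show ?thesis by simp
qed

text \<open>The norm of p(A) f is the L2 norm of p with respect to \<open>M f\<close>. Polynomials
  tending boundedly to the indicator therefore give a Cauchy sequence at each vector, and the strong
  limit inherits symmetry and commutation with every bounded operator commuting with
  \<open>A\<close>. Since \<open>c\<close> is common to all vectors, one sequence of polynomials
  serves them all.\<close>

lemma spectral_projection_exists:
  fixes A :: "'h::{real_inner,complete_space} \<Rightarrow> 'h"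
  assumes A: "symmetric_op A" and M: "\<And>f. spectral_measure_of A f c (M f)"
  shows "\<exists>P. orth_projection P \<and> (\<forall>f. P f \<bullet> f = measure (M f) {..l}) \<and>
    (\<forall>f. A (P f) \<bullet> P f \<le> l * (P f \<bullet> P f)) \<and>
    (\<forall>B. bounded_linear B \<longrightarrow> (\<forall>f. B (A f) = A (B f)) \<longrightarrow> (\<forall>f. B (P f) = P (B f)))"
proof -
  obtain p :: "nat \<Rightarrow> real poly" where p:
      "\<And>n t. 0 \<le> t \<Longrightarrow> t \<le> c \<Longrightarrow> \<bar>poly (p n) t\<bar> \<le> 2"
      "\<And>t. 0 \<le> t \<Longrightarrow> t \<le> c \<Longrightarrow> (\<lambda>n. poly (p n) t) \<longlonglongrightarrow> indicator {..l} t"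
    by (rule poly_approx_indicator_atMost[of 0 c l]) blast
  have fin: "finite_measure (M f)" and sets: "sets (M f) = sets borel"
    and supp: "AE t in M f. 0 \<le> t \<and> t \<le> c" for f
    using M by (auto simp: spectral_measure_of_def)
  have sp: "space (M f) = UNIV" for f using sets by (metis sets_eq_imp_space_eq space_borel)
  have intg: "integrable (M f) (poly q)" for f q
    by (rule integrable_poly_compact_support[OF fin sets supp])
  note lin = symmetric_opD(1,2)[OF A]
  have inner: "poly_op A (r * q) f \<bullet> f = poly_op A r f \<bullet> poly_op A q f" for q r f
    using symmetric_opD(3)[OF symmetric_op_poly_op[OF A]] lin
    by (metis mult.commute poly_op_mult)
  have norm_eq: "(norm (poly_op A q f))\<^sup>2 = (\<integral>t. (poly q t)\<^sup>2 \<partial>M f)" for q f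
    using inner[of q q f] poly_op_inner_eq_integral[OF M[of f], of "q * q"]
    by (simp add: power2_norm_eq_inner flip: power2_eq_square)
  have Cauchy: "Cauchy (\<lambda>n. poly_op A (p n) f)" for f
  proof -
    interpret finite_measure "M f" by (rule fin)
    \<comment> \<open>\<open>e n\<close> is the squared L2 distance of \<open>p n\<close> from the
      indicator. It tends to 0, and the distance between two polynomials is estimated through
      it.\<close>
    define e where "e n = (\<integral>t. (poly (p n) t - indicator {..l} t)\<^sup>2 \<partial>M f)" for n
    have meas: "(\<lambda>t. (poly (p n) t - indicator {..l} t)\<^sup>2) \<in> borel_measurable (M f)" for n
      using intg[of f "p n", THEN borel_measurable_integrable]
      by (intro borel_measurable_power borel_measurable_diff borel_measurable_indicator) (auto simp: sets)
    have bnd: "AE t in M f. \<bar>(poly (p n) t - indicator {..l} t)\<^sup>2\<bar> \<le> 9" for n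
      using supp
    proof eventually_elim
      case (elim t)
      then have "\<bar>poly (p n) t - indicator {..l} t\<bar> \<le> 3"
        using p(1)[of t n] by (auto simp: indicator_def)
      then have "\<bar>poly (p n) t - indicator {..l} t\<bar>\<^sup>2 \<le> 3\<^sup>2" by (intro power_mono) auto
      then show ?case by simp
    qed
    have e_int: "integrable (M f) (\<lambda>t. (poly (p n) t - indicator {..l} t)\<^sup>2)" for n
      using bnd meas by (intro integrable_const_bound[of _ 9]) auto
    have "e \<longlonglongrightarrow> (\<integral>t. 0 \<partial>M f)"
      unfolding e_def
    proof (rule integral_dominated_convergence[where w = "\<lambda>t. 9"])
      show "AE t in M f. (\<lambda>n. (poly (p n) t - indicator {..l} t)\<^sup>2) \<longlonglongrightarrow> 0"
        using supp
      proof eventually_elim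
        case (elim t)
        then have "(\<lambda>n. (poly (p n) t - indicator {..l} t)\<^sup>2) \<longlonglongrightarrow> (indicator {..l} t - indicator {..l} t)\<^sup>2"
          by (intro tendsto_intros p(2)) auto
        then show ?case by simp
      qed
    qed (use meas bnd in auto)
    then have e0: "e \<longlonglongrightarrow> 0" by simp
    have dist2: "(norm (poly_op A (p n) f - poly_op A (p m) f))\<^sup>2 \<le> 2 * e n + 2 * e m" for n m
    proof -
      have "(norm (poly_op A (p n) f - poly_op A (p m) f))\<^sup>2 = (\<integral>t. (poly (p n) t - poly (p m) t)\<^sup>2 \<partial>M f)"
        using norm_eq[of "p n - p m" f] by (simp add: poly_op_diff)
      also have "\<dots> \<le> (\<integral>t. 2 * (poly (p n) t - indicator {..l} t)\<^sup>2 + 2 * (poly (p m) t - indicator {..l} t)\<^sup>2 \<partial>M f)"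
      proof (rule integral_mono)
        show "integrable (M f) (\<lambda>t. (poly (p n) t - poly (p m) t)\<^sup>2)"
          using intg[of f "(p n - p m) ^ 2"] by (simp add: poly_power[abs_def] poly_diff[abs_def])
        show "integrable (M f) (\<lambda>t. 2 * (poly (p n) t - indicator {..l} t)\<^sup>2 + 2 * (poly (p m) t - indicator {..l} t)\<^sup>2)"
          using e_int by (intro Bochner_Integration.integrable_add integrable_mult_right) auto
        fix t
        have "(x - y)\<^sup>2 \<le> 2 * (x - z)\<^sup>2 + 2 * (y - z)\<^sup>2" for x y z :: real
        proof -
          have "2 * (x - z)\<^sup>2 + 2 * (y - z)\<^sup>2 - (x - y)\<^sup>2 = (x + y - 2 * z)\<^sup>2"
            by (simp add: power2_eq_square algebra_simps)
          then show ?thesis by (metis diff_ge_0_iff_ge zero_le_power2)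
        qed
        then show "(poly (p n) t - poly (p m) t)\<^sup>2 \<le> 2 * (poly (p n) t - indicator {..l} t)\<^sup>2 + 2 * (poly (p m) t - indicator {..l} t)\<^sup>2" .
      qed
      also have "\<dots> = 2 * e n + 2 * e m"
        using e_int by (simp add: e_def)
      finally show ?thesis .
    qed
    show ?thesis
    proof (rule CauchyI)
      fix \<epsilon> :: real assume \<epsilon>: "0 < \<epsilon>"
      then obtain N where N: "\<And>n. n \<ge> N \<Longrightarrow> e n < \<epsilon>\<^sup>2 / 4"
        using order_tendstoD(2)[OF e0, of "\<epsilon>\<^sup>2 / 4"] by (auto simp: eventually_sequentially)
      have "norm (poly_op A (p m) f - poly_op A (p n) f) < \<epsilon>" if "m \<ge> N" "n \<ge> N" for m n
      proof -
        have "(norm (poly_op A (p m) f - poly_op A (p n) f))\<^sup>2 < \<epsilon>\<^sup>2"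
          using dist2[of m n] N[OF that(1)] N[OF that(2)] by linarith
        then show ?thesis using \<epsilon> by (simp add: power2_less_imp_less)
      qed
      then show "\<exists>N. \<forall>m\<ge>N. \<forall>n\<ge>N. norm (poly_op A (p m) f - poly_op A (p n) f) < \<epsilon>" by blast
    qed
  qed
  define P where "P f = lim (\<lambda>n. poly_op A (p n) f)" for f
  have P_lim: "(\<lambda>n. poly_op A (p n) f) \<longlonglongrightarrow> P f" for f
    using Cauchy[of f] by (simp add: P_def Cauchy_convergent_iff convergent_LIMSEQ_iff)
  have PP_le: "(norm (P f))\<^sup>2 = measure (M f) {..l}" for f
  proof -
    interpret finite_measure "M f" by (rule fin)
    have "(\<lambda>n. (norm (poly_op A (p n) f))\<^sup>2) \<longlonglongrightarrow> (norm (P f))\<^sup>2"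
      by (intro tendsto_intros P_lim)
    moreover have "(\<lambda>n. (norm (poly_op A (p n) f))\<^sup>2) \<longlonglongrightarrow> (\<integral>t. (indicator {..l} t)\<^sup>2 \<partial>M f)"
      unfolding norm_eq
    proof (rule integral_dominated_convergence[where w = "\<lambda>t. 4"])
      show "AE t in M f. (\<lambda>n. (poly (p n) t)\<^sup>2) \<longlonglongrightarrow> (indicator {..l} t)\<^sup>2"
        using supp by eventually_elim (auto intro!: tendsto_power p(2))
      show "AE t in M f. norm ((poly (p n) t)\<^sup>2) \<le> 4" for n
        using supp
      proof eventually_elim
        case (elim t)
        then have "\<bar>poly (p n) t\<bar>\<^sup>2 \<le> 2\<^sup>2" using p(1) by (intro power_mono) auto
        then show ?case by simp
      qed
      show "(\<lambda>t. (poly (p n) t)\<^sup>2) \<in> borel_measurable (M f)" for n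
        using intg by (intro borel_measurable_power) auto
    qed (auto simp: sets intro!: borel_measurable_power borel_measurable_indicator)
    moreover have "(\<lambda>t. (indicator {..l} t :: real)\<^sup>2) = indicator {..l}"
      by (auto simp: indicator_def)
    ultimately show ?thesis using LIMSEQ_unique by (fastforce simp: sets sp)
  qed
  have P_inner: "P f \<bullet> f = measure (M f) {..l}" for f
  proof -
    have "(\<lambda>n. poly_op A (p n) f \<bullet> f) \<longlonglongrightarrow> P f \<bullet> f" by (intro tendsto_intros P_lim)
    moreover have "(\<lambda>n. poly_op A (p n) f \<bullet> f) \<longlonglongrightarrow> (\<integral>t. indicator {..l} t \<partial>M f)"
      using integral_poly_tendsto_indicator[OF fin[of f] sets[of f] supp[of f] p, of 1] poly_op_inner_eq_integral[OF M]
      by simp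
    ultimately show ?thesis using LIMSEQ_unique by (fastforce simp: sets sp)
  qed
  have P_sym: "P f \<bullet> g = f \<bullet> P g" for f g
  proof -
    have "(\<lambda>n. poly_op A (p n) f \<bullet> g) \<longlonglongrightarrow> P f \<bullet> g" by (intro tendsto_intros P_lim)
    moreover have "(\<lambda>n. f \<bullet> poly_op A (p n) g) \<longlonglongrightarrow> f \<bullet> P g" by (intro tendsto_intros P_lim)
    ultimately show ?thesis
      using LIMSEQ_unique symmetric_opD(3)[OF symmetric_op_poly_op[OF A]] by simp
  qed
  have bl: "bounded_linear P"
  proof (rule bounded_linear_intro[where K = 1])
    fix f g and r :: real
    note L = bounded_linear.linear[OF bounded_linear_poly_op[OF lin(1)]]
    have "(\<lambda>n. poly_op A (p n) (f + g)) \<longlonglongrightarrow> P f + P g"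
      unfolding linear_add[OF L] by (intro tendsto_add P_lim)
    then show "P (f + g) = P f + P g" using P_lim LIMSEQ_unique by blast
    have "(\<lambda>n. poly_op A (p n) (r *\<^sub>R f)) \<longlonglongrightarrow> r *\<^sub>R P f"
      unfolding linear_scale[OF L] by (intro tendsto_scaleR tendsto_const P_lim)
    then show "P (r *\<^sub>R f) = r *\<^sub>R P f" using P_lim LIMSEQ_unique by blast
    have "measure (M f) {..l} \<le> measure (M f) UNIV"
      by (rule finite_measure.finite_measure_mono[OF fin]) (auto simp: sets)
    then have "(norm (P f))\<^sup>2 \<le> (norm f)\<^sup>2"
      unfolding PP_le measure_space_spectral_measure[OF M] by (simp add: power2_norm_eq_inner)
    then show "norm (P f) \<le> norm f * 1" using power2_le_imp_le[OF _ norm_ge_zero] by simp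
  qed
  have symP: "symmetric_op P" using bl P_sym by (simp add: symmetric_op_def)
  \<comment> \<open>Both |P f|^2 and <P f, f> equal the mass of the half-line, so the difference of
    P^2 and P has zero quadratic form.\<close>
  define D where "D f = P (P f) - P f" for f
  have "symmetric_op D"
    unfolding symmetric_op_def D_def
    using bl P_sym by (auto simp: inner_diff_left inner_diff_right intro: bounded_linear_sub bounded_linear_compose)
  moreover have "D f \<bullet> f = 0" for f
    using PP_le[of f] P_inner[of f] P_sym[of "P f" f]
    by (simp add: D_def inner_diff_left power2_norm_eq_inner)
  ultimately have "D f = 0" for f by (rule symmetric_op_zeroI)
  then have idem: "P (P f) = P f" for f by (simp add: D_def)
  have comm: "B (P f) = P (B f)" if B: "bounded_linear B" "\<forall>f. B (A f) = A (B f)" for B f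
  proof -
    have "(\<lambda>n. B (poly_op A (p n) f)) \<longlonglongrightarrow> B (P f)"
      by (rule bounded_linear.tendsto[OF B(1) P_lim])
    moreover have "B (poly_op A (p n) f) = poly_op A (p n) (B f)" for n
      using B by (intro poly_op_commute) (auto intro: bounded_linear.linear)
    ultimately show ?thesis using LIMSEQ_unique[OF _ P_lim[of "B f"]] by simp
  qed
  have form: "A (P f) \<bullet> P f \<le> l * (P f \<bullet> P f)" for f
  proof -
    interpret finite_measure "M f" by (rule fin)
    have X: "poly_op A [:0, 1:] g = A g" for g
      using lin by (simp add: poly_op_pCons linear_0)
    \<comment> \<open>One copy of P is absorbed by idempotence. The form then becomes the integral
      of t over the half-line, where t is at most l.\<close>
    have "A (P f) \<bullet> P f = A (P f) \<bullet> f"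
      using P_sym[of "A (P f)" f] idem comm[OF lin(1)] by simp
    moreover have "(\<lambda>n. A (poly_op A (p n) f) \<bullet> f) \<longlonglongrightarrow> A (P f) \<bullet> f"
      by (intro tendsto_intros bounded_linear.tendsto[OF lin(1)] P_lim)
    moreover have "A (poly_op A (p n) f) \<bullet> f = (\<integral>t. poly [:0, 1:] t * poly (p n) t \<partial>M f)" for n
      using poly_op_inner_eq_integral[OF M[of f], of "[:0, 1:] * p n"]
      by (simp add: poly_op_mult[OF lin(1), of "[:0,1:]"] X del: mult_pCons_left)
    ultimately have "A (P f) \<bullet> P f = (\<integral>t. poly [:0, 1:] t * indicator {..l} t \<partial>M f)"
      using integral_poly_tendsto_indicator[OF fin[of f] sets[of f] supp[of f] p, of "[:0, 1:]"] LIMSEQ_unique by simp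
    also have "\<dots> \<le> (\<integral>t. l * indicator {..l} t \<partial>M f)"
    proof (rule integral_mono)
      show "integrable (M f) (\<lambda>t. poly [:0, 1:] t * indicator {..l} t)"
        using intg[of f "[:0, 1:]"] by (intro integrable_real_mult_indicator) (auto simp: sets poly_pCons[abs_def])
      show "integrable (M f) (\<lambda>t. l * indicator {..l} t)"
        by (intro integrable_mult_right integrable_real_indicator) (auto simp: sets emeasure_eq_measure)
    qed (auto simp: indicator_def)
    also have "\<dots> = l * measure (M f) {..l}" by (simp add: sets sp)
    finally show ?thesis using PP_le[of f] by (simp add: power2_norm_eq_inner)
  qed
  show ?thesis
    using symP idem P_inner form comm unfolding orth_projection_def by blast
qed

text \<open>The measure lives on t > l and has positive mass because f is nonzero, so integrating t
  > l stays strict. Strictness is what later contradicts an upper bound on the form.\<close>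

lemma spectral_form_gt:
  assumes M: "spectral_measure_of A f c M" and zero: "measure M {..l} = 0" and f: "f \<noteq> 0"
  shows "l * (f \<bullet> f) < A f \<bullet> f"
proof -
  interpret finite_measure M using M by (simp add: spectral_measure_of_def)
  have sets: "sets M = sets borel" and supp: "AE t in M. 0 \<le> t \<and> t \<le> c"
    using M by (auto simp: spectral_measure_of_def)
  have sp: "space M = UNIV" using sets by (metis sets_eq_imp_space_eq space_borel)
  have AE: "AE t in M. l < t"
  proof (rule AE_I')
    show "{..l} \<in> null_sets M" using zero sets by (auto simp: null_sets_def emeasure_eq_measure)
  qed auto
  have int: "integrable M (\<lambda>t. t)"
    using integrable_poly_compact_support[OF finite_measure_axioms sets supp, of "[:0, 1:]"]
    by (simp add: poly_pCons[abs_def])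
  have "A f \<bullet> f = (\<integral>t. t \<partial>M)"
    using M[unfolded spectral_measure_of_def] by (auto dest!: spec[of _ 1])
  moreover have "l * (f \<bullet> f) = (\<integral>t. l \<partial>M)"
    using measure_space_spectral_measure[OF M] by (simp add: sp mult.commute)
  moreover have "(\<integral>t. l \<partial>M) < (\<integral>t. t \<partial>M)"
  proof (rule integral_less_AE_space)
    show "emeasure M (space M) \<noteq> 0"
      using measure_space_spectral_measure[OF M] f by (simp add: sp emeasure_eq_measure)
  qed (use int AE in auto)
  ultimately show ?thesis by (simp only:)
qed

section \<open>Comparing two projections through powers of a compression\<close>

lemma positive_contraction_power_converges:
  fixes C :: "'h::{real_inner,complete_space} \<Rightarrow> 'h"
  assumes C: "symmetric_op C" and pos: "\<And>f. 0 \<le> C f \<bullet> f" and le: "\<And>f. C f \<bullet> f \<le> f \<bullet> f"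
  obtains w where "(\<lambda>n. (C ^^ n) u) \<longlonglongrightarrow> w" "C w = w"
proof -
  note lin = symmetric_opD(1,2)[OF C]
  \<comment> \<open>\<open>b\<close> is decreasing and nonnegative, hence convergent. The squared
    distance of two iterates combines its values at 2 m, m + n and 2 n with coefficients 1, -2 and
    1, so the iterates are Cauchy.\<close>
  define b where "b n = (C ^^ n) u \<bullet> u" for n
  have b0: "0 \<le> b n" for n
    using positive_contraction_power_inner_nonneg[OF C pos le, of n 0 u]
    by (simp add: b_def poly_op_X_power lin)
  have dec: "b (Suc n) \<le> b n" for n
  proof -
    have "[:0, 1:] ^ n * [:1, - 1:] ^ 1 = [:0, 1:] ^ n - [:0, 1 :: real:] ^ Suc n"
    proof -
      have "[:1, - 1 :: real:] = 1 - [:0, 1:]" by (simp add: one_pCons)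
      then show ?thesis
        by (simp only: power_one_right right_diff_distrib mult_1_right power_Suc mult.commute[of "[:0, 1:]"])
    qed
    then have "0 \<le> poly_op C ([:0, 1:] ^ n - [:0, 1 :: real:] ^ Suc n) u \<bullet> u"
      using positive_contraction_power_inner_nonneg[OF C pos le, of n 1 u] by (simp only:)
    then show ?thesis
      unfolding poly_op_diff poly_op_X_power[OF lin(1)] by (simp only: b_def inner_diff_left diff_ge_0_iff_ge)
  qed
  obtain L where L: "b \<longlonglongrightarrow> L"
    using decseq_convergent[of b 0] dec b0 by (metis decseq_Suc_iff)
  have inner: "(C ^^ n) u \<bullet> (C ^^ m) u = b (n + m)" for n m
    using symmetric_opD(3)[OF symmetric_op_funpow[OF C], of m "(C ^^ n) u" u]
    by (simp add: b_def funpow_add add.commute[of n m])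
  have dist2: "(norm ((C ^^ m) u - (C ^^ n) u))\<^sup>2 = b (m + m) - 2 * b (m + n) + b (n + n)" for m n
    by (simp add: power2_norm_eq_inner inner_diff_left inner_diff_right inner add.commute)
  have "Cauchy (\<lambda>n. (C ^^ n) u)"
  proof (rule CauchyI)
    fix \<epsilon> :: real assume \<epsilon>: "0 < \<epsilon>"
    then obtain N where N: "\<And>n. n \<ge> N \<Longrightarrow> norm (b n - L) < \<epsilon>\<^sup>2 / 4"
      using LIMSEQ_D[OF L, of "\<epsilon>\<^sup>2 / 4"] by auto
    have "norm ((C ^^ m) u - (C ^^ n) u) < \<epsilon>" if "m \<ge> N" "n \<ge> N" for m n
    proof -
      have "(norm ((C ^^ m) u - (C ^^ n) u))\<^sup>2 < \<epsilon>\<^sup>2"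
        using dist2[of m n] N[of "m + m"] N[of "m + n"] N[of "n + n"] that
        by (simp only: real_norm_def abs_less_iff) auto
      then show ?thesis using power2_less_imp_less \<epsilon> by fastforce
    qed
    then show "\<exists>N. \<forall>m\<ge>N. \<forall>n\<ge>N. norm ((C ^^ m) u - (C ^^ n) u) < \<epsilon>" by blast
  qed
  then obtain w where w: "(\<lambda>n. (C ^^ n) u) \<longlonglongrightarrow> w"
    by (auto simp: Cauchy_convergent_iff convergent_def)
  have "(\<lambda>n. (C ^^ Suc n) u) \<longlonglongrightarrow> C w"
    using bounded_linear.tendsto[OF lin(1) w] by simp
  moreover have "(\<lambda>n. (C ^^ Suc n) u) \<longlonglongrightarrow> w" by (rule LIMSEQ_Suc[OF w])
  ultimately have "C w = w" by (rule LIMSEQ_unique)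
  with w that show ?thesis by blast
qed

lemma orth_projectionD:
  assumes "orth_projection P"
  shows "symmetric_op P" "bounded_linear P" "linear P" "P f \<bullet> g = f \<bullet> P g" "P (P f) = P f"
    "P f \<bullet> f = P f \<bullet> P f" "norm (P f) \<le> norm f"
proof -
  show *: "symmetric_op P" "P (P f) = P f" using assms by (auto simp: orth_projection_def)
  show "bounded_linear P" "linear P" "P f \<bullet> g = f \<bullet> P g" using symmetric_opD[OF *(1)] by auto
  show **: "P f \<bullet> f = P f \<bullet> P f" using symmetric_opD(3)[OF *(1), of "P f" f] *(2) by simp
  have "norm (P f) * norm (P f) = P f \<bullet> f" using ** by (simp add: dot_square_norm power2_eq_square)
  also have "\<dots> \<le> norm (P f) * norm f" by (rule norm_cauchy_schwarz)
  finally show "norm (P f) \<le> norm f"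
    using norm_ge_zero[of "P f"] by (cases "norm (P f) = 0") (auto simp: mult_le_cancel_left)
qed

text \<open>C = 1 - PQP is the identity on the kernel of P and preserves the range of P. Hence 1 -
  C^n kills the component of f in the kernel, and its form at f is its form at P f.\<close>

lemma compressed_projection_power:
  assumes P: "orth_projection P" and Q: "orth_projection Q"
    and C_def: "C = (\<lambda>f. f - P (Q (P f)))"
  shows "symmetric_op C" "0 \<le> C f \<bullet> f" "C f \<bullet> f \<le> f \<bullet> f"
    "P ((C ^^ n) (P f)) = (C ^^ n) (P f)"
    "(f - (C ^^ n) f) \<bullet> f = P f \<bullet> f - (C ^^ n) (P f) \<bullet> P f"
proof -
  note P' = orth_projectionD[OF P] and Q' = orth_projectionD[OF Q]
  have bl: "bounded_linear C"
    unfolding C_def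
    by (intro bounded_linear_sub bounded_linear_ident
          bounded_linear_compose[OF P'(2)] bounded_linear_compose[OF Q'(2)] P'(2))
  show "symmetric_op C"
    unfolding symmetric_op_def using bl P'(4) Q'(4) by (simp add: C_def inner_diff_left inner_diff_right)
  have S: "P (Q (P f)) \<bullet> f = (norm (Q (P f)))\<^sup>2"
    using P'(4)[of "Q (P f)" f] Q'(6)[of "P f"] by (simp add: power2_norm_eq_inner)
  have "norm (Q (P f)) \<le> norm f" using P'(7)[of f] Q'(7)[of "P f"] by simp
  then have "(norm (Q (P f)))\<^sup>2 \<le> (norm f)\<^sup>2" by (intro power_mono) auto
  then show "0 \<le> C f \<bullet> f" "C f \<bullet> f \<le> f \<bullet> f"
    using S by (auto simp: C_def inner_diff_left power2_norm_eq_inner)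
  have PC: "P (C g) = C (P g)" for g
    using P' by (simp add: C_def linear_diff)
  have PCn: "P ((C ^^ n) g) = (C ^^ n) (P g)" for n g by (induction n) (auto simp: PC)
  then show PCP: "P ((C ^^ n) (P f)) = (C ^^ n) (P f)" using P'(5) by simp
  have "C (f - P f) = f - P f" using P' Q'(3) by (simp add: C_def linear_diff linear_0)
  then have "(C ^^ n) (f - P f) = f - P f" by (induction n) auto
  then have "(C ^^ n) f = f - P f + (C ^^ n) (P f)"
    using linear_funpow[OF bounded_linear.linear[OF bl], of n] by (simp add: linear_diff algebra_simps)
  then have "(f - (C ^^ n) f) \<bullet> f = P f \<bullet> f - (C ^^ n) (P f) \<bullet> f"
    by (simp add: inner_diff_left inner_add_left)
  also have "(C ^^ n) (P f) \<bullet> f = (C ^^ n) (P f) \<bullet> P f"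
    using P'(4)[of "(C ^^ n) (P f)" f] PCP by simp
  finally show "(f - (C ^^ n) f) \<bullet> f = P f \<bullet> f - (C ^^ n) (P f) \<bullet> P f" .
qed

text \<open>The hypothesis \<open>tr\<close> is the trace property seen at a single vector. It
  equates the forms of 1 - C^n and 1 - C'^n at \<open>d\<close>. The first tends to <P d, d>, since
  the powers of C applied to P d tend to 0; the second is <Q d, d> minus something
  nonnegative.\<close>

lemma projection_inner_le:
  fixes P Q :: "'h::{real_inner,complete_space} \<Rightarrow> 'h"
  assumes P: "orth_projection P" and Q: "orth_projection Q"
    and inj: "\<And>f. P f = f \<Longrightarrow> Q f = 0 \<Longrightarrow> f = 0"
    and tr: "\<And>k. 0 < k \<Longrightarrow> ((\<lambda>f. P (Q (P f))) ^^ k) d \<bullet> d = ((\<lambda>f. Q (P (Q f))) ^^ k) d \<bullet> d"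
  shows "P d \<bullet> d \<le> Q d \<bullet> d"
proof -
  note P' = orth_projectionD[OF P] and Q' = orth_projectionD[OF Q]
  define S where "S = (\<lambda>f. P (Q (P f)))"
  define S' where "S' = (\<lambda>f. Q (P (Q f)))"
  define C where "C = (\<lambda>f. f - P (Q (P f)))"
  define C' where "C' = (\<lambda>f. f - Q (P (Q f)))"
  note C = compressed_projection_power[OF P Q C_def]
  note C' = compressed_projection_power[OF Q P C'_def]
  have bl: "bounded_linear S" "bounded_linear S'"
    unfolding S_def S'_def
    by (intro bounded_linear_compose[OF P'(2)] bounded_linear_compose[OF Q'(2)] P'(2) Q'(2))+
  have pow: "poly_op A ([:1, - 1:] ^ n) f = ((\<lambda>f. f - A f) ^^ n) f" if "bounded_linear A" for A n and f :: 'h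
    using that bounded_linear.linear[OF that]
    by (induction n) (simp_all add: poly_op_mult poly_op_pCons linear_0 linear_neg del: mult_pCons_left)
  have eq: "(d - (C ^^ n) d) \<bullet> d = (d - (C' ^^ n) d) \<bullet> d" for n
  proof -
    \<comment> \<open>The polynomial 1 - (1 - t)^n has no constant term, so only positive powers
      occur, the ones covered by \<open>tr\<close>.\<close>
    define r where "r = 1 - [:1, - 1 :: real:] ^ n"
    have "poly r 0 = 0" by (simp add: r_def)
    then have r0: "coeff r 0 = 0" by (simp add: poly_0_coeff_0)
    have "poly_op S r d \<bullet> d = poly_op S' r d \<bullet> d"
      unfolding poly_op_def inner_sum_left
    proof (rule sum.cong)
      fix i
      show "coeff r i *\<^sub>R (S ^^ i) d \<bullet> d = coeff r i *\<^sub>R (S' ^^ i) d \<bullet> d"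
        using tr[of i] r0 by (cases "i = 0") (auto simp: S_def S'_def)
    qed simp
    then show ?thesis by (simp add: r_def poly_op_diff pow[OF bl(1)] pow[OF bl(2)])
        (simp add: C_def C'_def S_def S'_def)
  qed
  obtain w where w: "(\<lambda>n. (C ^^ n) (P d)) \<longlonglongrightarrow> w" "C w = w"
    by (rule positive_contraction_power_converges[OF C(1-3), of "P d"])
  have "(\<lambda>n. P ((C ^^ n) (P d))) \<longlonglongrightarrow> P w" by (rule bounded_linear.tendsto[OF P'(2) w(1)])
  then have Pw: "P w = w" using LIMSEQ_unique w(1) unfolding C(4) by blast
  \<comment> \<open>A fixed vector of C is killed by PQP. As \<open>w\<close> lies in the range of
    P, this forces |Q w|^2 = <PQP w, w> = 0, and \<open>inj\<close> applies.\<close>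
  have "S w = 0" using w(2) by (simp add: C_def S_def)
  then have "Q w \<bullet> Q w = 0"
    using P'(4)[of "Q w" w] Q'(6)[of w] Pw by (simp add: S_def)
  then have "w = 0" using inj Pw by simp
  then have "(\<lambda>n. (C ^^ n) (P d) \<bullet> P d) \<longlonglongrightarrow> 0"
    using tendsto_inner[OF w(1) tendsto_const[of "P d"]] by simp
  then have "(\<lambda>n. P d \<bullet> d - (C ^^ n) (P d) \<bullet> P d) \<longlonglongrightarrow> P d \<bullet> d - 0"
    by (intro tendsto_diff tendsto_const)
  moreover have "P d \<bullet> d - (C ^^ n) (P d) \<bullet> P d \<le> Q d \<bullet> d" for n
  proof -
    have "0 \<le> (C' ^^ n) (Q d) \<bullet> Q d"
      using positive_contraction_power_inner_nonneg[OF C'(1-3), of n 0 "Q d"]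
      by (simp add: poly_op_X_power symmetric_opD(1)[OF C'(1)])
    then show ?thesis using C(5)[of d n] C'(5)[of d n] eq[of n] by simp
  qed
  ultimately show ?thesis by (intro LIMSEQ_le_const2) auto
qed

section \<open>The Hilbert space of square-summable functions\<close>

text \<open>Functions live on the whole type rather than on the group, so that the space is a type
  and can be an instance of the Hilbert space classes. Functions on the group are the vectors fixed
  by \<open>carrier_restrict\<close>.\<close>

typedef 'a ell2 = "{f :: 'a \<Rightarrow> complex. (\<lambda>x. (cmod (f x))\<^sup>2) summable_on UNIV}"
  morphisms ell2_fun Abs_ell2
  by (rule exI[of _ "\<lambda>_. 0"]) simp

setup_lifting type_definition_ell2

lemma ell2_eqI: "(\<And>x. ell2_fun f x = ell2_fun g x) \<Longrightarrow> f = g"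
  using ell2_fun_inject by blast

lemma square_add_le: "(cmod (a + b))\<^sup>2 \<le> 2 * (cmod a)\<^sup>2 + 2 * (cmod b)\<^sup>2"
proof -
  have "(cmod (a + b))\<^sup>2 \<le> (cmod a + cmod b)\<^sup>2" by (intro power_mono norm_triangle_ineq) auto
  also have "\<dots> \<le> 2 * (cmod a)\<^sup>2 + 2 * (cmod b)\<^sup>2"
    using sum_squares_bound[of "cmod a" "cmod b"] by (simp add: power2_sum)
  finally show ?thesis .
qed

lemma summable_on_comparison_nonneg:
  fixes f g :: "'a \<Rightarrow> real"
  assumes "g summable_on X" "\<And>x. x \<in> X \<Longrightarrow> 0 \<le> f x" "\<And>x. x \<in> X \<Longrightarrow> f x \<le> g x"
  shows "f summable_on X"
proof -
  have g: "norm (g x) = g x" and f: "norm (f x) \<le> norm (g x)" if "x \<in> X" for x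
    using assms(2,3)[OF that] by auto
  have "(\<lambda>x. norm (g x)) summable_on X"
    using assms(1) summable_on_cong[of X "\<lambda>x. norm (g x)" g, OF g] by blast
  then have "(\<lambda>x. norm (f x)) summable_on X"
    by (rule Infinite_Sum.abs_summable_on_comparison_test[OF _ f])
  then show ?thesis by (rule abs_summable_summable)
qed

lemma square_summable_add:
  assumes "(\<lambda>x. (cmod (f x))\<^sup>2) summable_on X" "(\<lambda>x. (cmod (g x))\<^sup>2) summable_on X"
  shows "(\<lambda>x. (cmod (f x + g x))\<^sup>2) summable_on X"
  by (rule summable_on_comparison_nonneg[of "\<lambda>x. 2 * (cmod (f x))\<^sup>2 + 2 * (cmod (g x))\<^sup>2"])
     (auto intro!: summable_on_add summable_on_cmult_right assms square_add_le)

lemma square_summable_mult: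
  assumes "(\<lambda>x. (cmod (f x))\<^sup>2) summable_on X" "(\<lambda>x. (cmod (g x))\<^sup>2) summable_on X"
  shows "(\<lambda>x. f x * cnj (g x)) summable_on X"
proof -
  have "(\<lambda>x. cmod (f x * cnj (g x))) summable_on X"
  proof (rule summable_on_comparison_nonneg)
    show "(\<lambda>x. (cmod (f x))\<^sup>2 + (cmod (g x))\<^sup>2) summable_on X"
      by (intro summable_on_add assms)
    show "cmod (f x * cnj (g x)) \<le> (cmod (f x))\<^sup>2 + (cmod (g x))\<^sup>2" for x
    proof -
      have "0 \<le> cmod (f x) * cmod (g x)" by simp
      then show ?thesis
        using sum_squares_bound[of "cmod (f x)" "cmod (g x)"]
        unfolding norm_mult complex_mod_cnj mult.assoc by linarith
    qed
  qed simp
  then show ?thesis by (rule abs_summable_summable)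
qed

instantiation ell2 :: (type) real_vector
begin

lift_definition zero_ell2 :: "'a ell2" is "\<lambda>_. 0" by simp
lift_definition plus_ell2 :: "'a ell2 \<Rightarrow> 'a ell2 \<Rightarrow> 'a ell2" is "\<lambda>f g x. f x + g x"
  by (rule square_summable_add)
lift_definition uminus_ell2 :: "'a ell2 \<Rightarrow> 'a ell2" is "\<lambda>f x. - f x" by simp
lift_definition minus_ell2 :: "'a ell2 \<Rightarrow> 'a ell2 \<Rightarrow> 'a ell2" is "\<lambda>f g x. f x - g x"
  subgoal for f g using square_summable_add[of f UNIV "\<lambda>x. - g x"] by simp
  done
lift_definition scaleR_ell2 :: "real \<Rightarrow> 'a ell2 \<Rightarrow> 'a ell2" is "\<lambda>c f x. complex_of_real c * f x"
  by (simp add: norm_mult power_mult_distrib summable_on_cmult_right)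

instance
proof
  fix f g h :: "'a ell2" and a b :: real
  show "f + g + h = f + (g + h)" by transfer (simp add: add.assoc)
  show "f + g = g + f" by transfer (simp add: add.commute)
  show "0 + f = f" by transfer simp
  show "- f + f = 0" by transfer simp
  show "f - g = f + - g" by transfer simp
  show "a *\<^sub>R (f + g) = a *\<^sub>R f + a *\<^sub>R g" by transfer (simp add: distrib_left)
  show "(a + b) *\<^sub>R f = a *\<^sub>R f + b *\<^sub>R f" by transfer (simp add: distrib_right)
  show "a *\<^sub>R b *\<^sub>R f = (a * b) *\<^sub>R f" by transfer (simp add: mult.assoc)
  show "1 *\<^sub>R f = f" by transfer simp
qed

end

lemma ell2_summable_prod: "(\<lambda>x. ell2_fun f x * cnj (ell2_fun g x)) summable_on X"
proof -
  have "(\<lambda>x. ell2_fun f x * cnj (ell2_fun g x)) summable_on UNIV"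
    using ell2_fun[of f] ell2_fun[of g] by (intro square_summable_mult) auto
  then show ?thesis by (rule summable_on_subset_banach) simp
qed

instantiation ell2 :: (type) real_inner
begin

definition inner_ell2 :: "'a ell2 \<Rightarrow> 'a ell2 \<Rightarrow> real" where
  "inner_ell2 f g = Re (\<Sum>\<^sub>\<infinity>x. ell2_fun f x * cnj (ell2_fun g x))"
definition norm_ell2 :: "'a ell2 \<Rightarrow> real" where "norm_ell2 f = sqrt (f \<bullet> f)"
definition dist_ell2 :: "'a ell2 \<Rightarrow> 'a ell2 \<Rightarrow> real" where "dist_ell2 f g = norm (f - g)"
definition sgn_ell2 :: "'a ell2 \<Rightarrow> 'a ell2" where "sgn_ell2 f = f /\<^sub>R norm f"
definition uniformity_ell2 :: "('a ell2 \<times> 'a ell2) filter" where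
  "uniformity_ell2 = (INF e\<in>{0<..}. principal {(x, y). dist x y < e})"
definition open_ell2 :: "'a ell2 set \<Rightarrow> bool" where
  "open_ell2 U = (\<forall>x\<in>U. \<forall>\<^sub>F (x', y) in uniformity. x' = x \<longrightarrow> y \<in> U)"

instance
proof
  fix f g h :: "'a ell2" and r :: real
  show "dist f g = norm (f - g)" by (rule dist_ell2_def)
  show "sgn f = f /\<^sub>R norm f" by (rule sgn_ell2_def)
  show "(uniformity :: ('a ell2 \<times> 'a ell2) filter) = (INF e\<in>{0<..}. principal {(x, y). dist x y < e})"
    by (rule uniformity_ell2_def)
  show "open U = (\<forall>x\<in>U. \<forall>\<^sub>F (x', y) in uniformity. x' = x \<longrightarrow> y \<in> U)" for U :: "'a ell2 set"
    by (rule open_ell2_def)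
  show "norm f = sqrt (f \<bullet> f)" by (rule norm_ell2_def)
  show "f \<bullet> g = g \<bullet> f"
  proof -
    have "cnj (\<Sum>\<^sub>\<infinity>x. ell2_fun f x * cnj (ell2_fun g x)) = (\<Sum>\<^sub>\<infinity>x. ell2_fun g x * cnj (ell2_fun f x))"
      by (subst infsum_cnj[symmetric]) (simp add: mult.commute)
    from arg_cong[OF this, of Re] show ?thesis by (simp add: inner_ell2_def)
  qed
  show "(f + g) \<bullet> h = f \<bullet> h + g \<bullet> h"
    by (simp add: inner_ell2_def plus_ell2.rep_eq distrib_right infsum_add ell2_summable_prod)
  show "(r *\<^sub>R f) \<bullet> g = r * (f \<bullet> g)"
    by (simp add: inner_ell2_def scaleR_ell2.rep_eq mult.assoc infsum_cmult_right')
  have sq: "ell2_fun f x * cnj (ell2_fun f x) = complex_of_real ((cmod (ell2_fun f x))\<^sup>2)" for x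
    by (rule complex_norm_square[symmetric])
  have sum: "(\<lambda>x. (cmod (ell2_fun f x))\<^sup>2) summable_on UNIV" using ell2_fun[of f] by simp
  have ff: "f \<bullet> f = (\<Sum>\<^sub>\<infinity>x. (cmod (ell2_fun f x))\<^sup>2)"
    using infsum_Re[OF ell2_summable_prod[of f f UNIV]] by (simp add: inner_ell2_def sq)
  show "0 \<le> f \<bullet> f" unfolding ff by (intro infsum_nonneg) simp
  show "(f \<bullet> f = 0) = (f = 0)"
  proof
    assume "f \<bullet> f = 0"
    then have "(cmod (ell2_fun f x))\<^sup>2 = 0" for x
      unfolding ff by (intro nonneg_infsum_le_0D[OF _ sum]) auto
    then show "f = 0" by (intro ell2_eqI) (simp add: zero_ell2.rep_eq)
  next
    assume "f = 0" then show "f \<bullet> f = 0" by (simp add: inner_ell2_def zero_ell2.rep_eq)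
  qed
qed

end

lemma ell2_summable: "(\<lambda>x. (cmod (ell2_fun f x))\<^sup>2) summable_on X"
proof -
  have "(\<lambda>x. (cmod (ell2_fun f x))\<^sup>2) summable_on UNIV" using ell2_fun[of f] by simp
  then show ?thesis by (rule summable_on_subset_banach) simp
qed

lemma norm_ell2_square: "(norm f)\<^sup>2 = (\<Sum>\<^sub>\<infinity>x. (cmod (ell2_fun f x))\<^sup>2)"
proof -
  have "ell2_fun f x * cnj (ell2_fun f x) = complex_of_real ((cmod (ell2_fun f x))\<^sup>2)" for x
    by (rule complex_norm_square[symmetric])
  then show ?thesis
    using infsum_Re[OF ell2_summable_prod[of f f UNIV]] by (simp add: power2_norm_eq_inner inner_ell2_def)
qed

lemma sum_ell2_le_norm:
  assumes "finite F"
  shows "(\<Sum>x\<in>F. (cmod (ell2_fun f x))\<^sup>2) \<le> (norm f)\<^sup>2"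
  unfolding norm_ell2_square by (rule finite_sum_le_infsum) (auto simp: ell2_summable assms)

lemma cmod_ell2_le_norm: "cmod (ell2_fun f x) \<le> norm f"
  using sum_ell2_le_norm[of "{x}" f] by (intro power2_le_imp_le[OF _ norm_ge_zero]) simp

lemma bounded_linear_ell2_fun: "bounded_linear (\<lambda>f. ell2_fun f x)"
  by (rule bounded_linear_intro[where K = 1])
     (auto simp: plus_ell2.rep_eq scaleR_ell2.rep_eq scaleR_conv_of_real cmod_ell2_le_norm)

text \<open>Evaluation at a point is bounded, so a pointwise limit exists. The Cauchy bound on
  finite partial sums survives the passage to this limit, which yields both its square summability
  and convergence in norm.\<close>

instance ell2 :: (type) complete_space
proof
  fix X :: "nat \<Rightarrow> 'a ell2" assume X: "Cauchy X"
  have "convergent (\<lambda>n. ell2_fun (X n) x)" for x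
    using bounded_linear.Cauchy[OF bounded_linear_ell2_fun X] by (rule Cauchy_convergent)
  then obtain L where L: "\<And>x. (\<lambda>n. ell2_fun (X n) x) \<longlonglongrightarrow> L x"
    unfolding convergent_def by metis
  have bound: "(\<Sum>x\<in>F. (cmod (ell2_fun (X n) x - L x))\<^sup>2) \<le> e\<^sup>2"
    if "finite F" and N: "\<And>m n. m \<ge> N \<Longrightarrow> n \<ge> N \<Longrightarrow> norm (X m - X n) < e" "n \<ge> N" for F n e N
  proof (rule LIMSEQ_le_const2)
    show "(\<lambda>m. \<Sum>x\<in>F. (cmod (ell2_fun (X n) x - ell2_fun (X m) x))\<^sup>2) \<longlonglongrightarrow> (\<Sum>x\<in>F. (cmod (ell2_fun (X n) x - L x))\<^sup>2)"
      by (intro tendsto_intros L)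
    have "(\<Sum>x\<in>F. (cmod (ell2_fun (X n) x - ell2_fun (X m) x))\<^sup>2) \<le> e\<^sup>2" if "m \<ge> N" for m
    proof -
      have "(\<Sum>x\<in>F. (cmod (ell2_fun (X n) x - ell2_fun (X m) x))\<^sup>2) \<le> (norm (X n - X m))\<^sup>2"
        using sum_ell2_le_norm[OF \<open>finite F\<close>, of "X n - X m"] by (simp add: minus_ell2.rep_eq)
      also have "\<dots> \<le> e\<^sup>2" using N(1)[OF \<open>n \<ge> N\<close> that] by (intro power_mono) auto
      finally show ?thesis .
    qed
    then show "\<exists>N. \<forall>m\<ge>N. (\<Sum>x\<in>F. (cmod (ell2_fun (X n) x - ell2_fun (X m) x))\<^sup>2) \<le> e\<^sup>2" by blast
  qed
  have sum: "(\<lambda>x. (cmod (ell2_fun (X n) x - L x))\<^sup>2) summable_on UNIV"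
    if "\<And>m n. m \<ge> N \<Longrightarrow> n \<ge> N \<Longrightarrow> norm (X m - X n) < e" "n \<ge> N" for n e N
    by (rule nonneg_bdd_above_summable_on) (use bound[OF _ that] in \<open>auto intro!: bdd_aboveI2[of _ _ "e\<^sup>2"]\<close>)
  obtain N0 where N0: "\<And>m n. m \<ge> N0 \<Longrightarrow> n \<ge> N0 \<Longrightarrow> norm (X m - X n) < 1"
    using CauchyD[OF X, of 1] by auto
  have "(\<lambda>x. (cmod (ell2_fun (X N0) x + - (ell2_fun (X N0) x - L x)))\<^sup>2) summable_on UNIV"
    by (rule square_summable_add) (use sum[OF N0] in \<open>simp_all add: ell2_summable norm_minus_commute\<close>)
  then have "L \<in> {f. (\<lambda>x. (cmod (f x))\<^sup>2) summable_on UNIV}" by simp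
  then obtain l where l: "L = ell2_fun l" by (metis Abs_ell2_inverse)
  have "X \<longlonglongrightarrow> l"
  proof (rule LIMSEQ_I)
    fix r :: real assume r: "0 < r"
    then obtain N where N: "\<And>m n. m \<ge> N \<Longrightarrow> n \<ge> N \<Longrightarrow> norm (X m - X n) < r / 2"
      using CauchyD[OF X, of "r / 2"] by auto
    have "norm (X n - l) < r" if "n \<ge> N" for n
    proof -
      have "(norm (X n - l))\<^sup>2 \<le> (r / 2)\<^sup>2"
        unfolding norm_ell2_square
      proof (rule infsum_le_finite_sums)
        show "(\<Sum>x\<in>F. (cmod (ell2_fun (X n - l) x))\<^sup>2) \<le> (r / 2)\<^sup>2" if "finite F" for F
          using bound[OF that N \<open>n \<ge> N\<close>] by (simp add: minus_ell2.rep_eq l)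
      qed (simp add: ell2_summable)
      then have "norm (X n - l) \<le> r / 2" by (rule power2_le_imp_le) (use r in simp)
      then show ?thesis using r by simp
    qed
    then show "\<exists>no. \<forall>n\<ge>no. norm (X n - l) < r" by blast
  qed
  then show "convergent X" by (auto simp: convergent_def)
qed

instance ell2 :: (type) banach ..

section \<open>Complex structure and composition operators\<close>

lift_definition ell2_mult_i :: "'a ell2 \<Rightarrow> 'a ell2" is "\<lambda>f x. \<i> * f x"
  by (simp add: norm_mult)

lift_definition ell2_cnj :: "'a ell2 \<Rightarrow> 'a ell2" is "\<lambda>f x. cnj (f x)"
  by simp

text \<open>The sum is conjugate linear in \<open>g\<close>, and Re (-i z) = Im z. The real inner
  product together with multiplication by i thus determines the complex inner product.\<close>

lemma Im_ell2_sum: "f \<bullet> ell2_mult_i g = Im (\<Sum>\<^sub>\<infinity>x. ell2_fun f x * cnj (ell2_fun g x))"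
proof -
  have "(\<Sum>\<^sub>\<infinity>x. ell2_fun f x * cnj (ell2_fun (ell2_mult_i g) x)) =
      (\<Sum>\<^sub>\<infinity>x. - \<i> * (ell2_fun f x * cnj (ell2_fun g x)))"
    by (rule infsum_cong) (simp add: ell2_mult_i.rep_eq)
  also have "\<dots> = - \<i> * (\<Sum>\<^sub>\<infinity>x. ell2_fun f x * cnj (ell2_fun g x))"
    by (rule infsum_cmult_right')
  finally show ?thesis by (simp add: inner_ell2_def)
qed

lemma inner_ell2_mult_i_right: "f \<bullet> ell2_mult_i g = - (ell2_mult_i f \<bullet> g)"
proof -
  have "(\<Sum>\<^sub>\<infinity>x. ell2_fun (ell2_mult_i f) x * cnj (ell2_fun g x)) =
      (\<Sum>\<^sub>\<infinity>x. \<i> * (ell2_fun f x * cnj (ell2_fun g x)))"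
    by (rule infsum_cong) (simp add: ell2_mult_i.rep_eq)
  also have "\<dots> = \<i> * (\<Sum>\<^sub>\<infinity>x. ell2_fun f x * cnj (ell2_fun g x))"
    by (rule infsum_cmult_right')
  finally have "ell2_mult_i f \<bullet> g = - Im (\<Sum>\<^sub>\<infinity>x. ell2_fun f x * cnj (ell2_fun g x))"
    by (simp add: inner_ell2_def)
  then show ?thesis by (simp add: Im_ell2_sum)
qed

lemma ell2_mult_i_mult_i: "ell2_mult_i (ell2_mult_i f) = - f"
  by transfer (simp add: mult.assoc[symmetric])

lemma linear_ell2_mult_i: "linear ell2_mult_i"
  by (intro linearI; transfer) (simp_all add: algebra_simps)

lemma bounded_linear_ell2_mult_i: "bounded_linear ell2_mult_i"
proof (rule bounded_linear_intro[where K = 1])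
  fix f :: "'a ell2"
  have "(norm (ell2_mult_i f))\<^sup>2 = (norm f)\<^sup>2"
    by (simp add: norm_ell2_square ell2_mult_i.rep_eq norm_mult)
  then show "norm (ell2_mult_i f) \<le> norm f * 1" by simp
qed (simp_all add: linear_add linear_scale linear_ell2_mult_i)

lemma inner_ell2_cnj: "ell2_cnj f \<bullet> ell2_cnj g = f \<bullet> g"
proof -
  have "(\<Sum>\<^sub>\<infinity>x. ell2_fun (ell2_cnj f) x * cnj (ell2_fun (ell2_cnj g) x)) =
      cnj (\<Sum>\<^sub>\<infinity>x. ell2_fun f x * cnj (ell2_fun g x))"
    by (subst infsum_cnj[symmetric]) (simp add: ell2_cnj.rep_eq)
  then show ?thesis by (simp add: inner_ell2_def)
qed

text \<open>Complex polarization: each vanishing form gives an antisymmetry relation, and putting i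
  g for g in the first relation makes its second term opposite to that of the second. It serves the
  uniqueness of an operator with a given complex quadratic form, where symmetry is not known
  beforehand.\<close>

lemma complex_linear_zeroI:
  fixes D :: "'a ell2 \<Rightarrow> 'a ell2"
  assumes add: "\<And>f g. D (f + g) = D f + D g"
    and J: "\<And>f. D (ell2_mult_i f) = ell2_mult_i (D f)"
    and zero: "\<And>f. D f \<bullet> f = 0" "\<And>f. D f \<bullet> ell2_mult_i f = 0"
  shows "D f = 0"
proof -
  let ?J = ell2_mult_i
  have 1: "D f \<bullet> g + D g \<bullet> f = 0" for f g
    using zero(1)[of "f + g"] zero(1)[of f] zero(1)[of g] by (simp add: add inner_add_left inner_add_right)
  have 2: "D f \<bullet> ?J g + D g \<bullet> ?J f = 0" for f g
    using zero(2)[of "f + g"] zero(2)[of f] zero(2)[of g]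
    by (simp add: add inner_add_left inner_add_right linear_add[OF linear_ell2_mult_i])
  have "D f \<bullet> ?J g = 0" for g
    using 1[of f "?J g"] 2[of f g] inner_ell2_mult_i_right[of "D g" f] by (simp add: J)
  from this[of "?J (D f)"] show ?thesis by (simp add: ell2_mult_i_mult_i)
qed

lemma square_summable_pull:
  assumes "(\<lambda>x. (cmod (f x))\<^sup>2) summable_on UNIV" "inj_on \<phi> X"
  shows "(\<lambda>x. (cmod (if x \<in> X then f (\<phi> x) else 0))\<^sup>2) summable_on UNIV"
proof -
  have "(\<lambda>y. (cmod (f y))\<^sup>2) summable_on \<phi> ` X"
    using assms(1) by (rule summable_on_subset_banach) simp
  then have "(\<lambda>x. (cmod (f (\<phi> x)))\<^sup>2) summable_on X"
    using summable_on_reindex[OF assms(2), of "\<lambda>y. (cmod (f y))\<^sup>2"] by (simp add: comp_def)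
  then show ?thesis by (rule summable_on_cong_neutral[THEN iffD1, rotated -1]) auto
qed

text \<open>Composition with a map that is not injective on \<open>X\<close> is given the junk value \<open>0\<close>.\<close>

lift_definition pull :: "'a set \<Rightarrow> ('a \<Rightarrow> 'a) \<Rightarrow> 'a ell2 \<Rightarrow> 'a ell2" is
  "\<lambda>X \<phi> f x. if inj_on \<phi> X \<and> x \<in> X then f (\<phi> x) else 0"
  subgoal for X \<phi> f using square_summable_pull[of f \<phi> X] by (cases "inj_on \<phi> X") auto
  done

lemma norm_pull_le: "norm (pull X \<phi> f) \<le> norm f"
proof (cases "inj_on \<phi> X")
  case True
  have "(norm (pull X \<phi> f))\<^sup>2 = (\<Sum>\<^sub>\<infinity>x\<in>X. (cmod (ell2_fun f (\<phi> x)))\<^sup>2)"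
    unfolding norm_ell2_square by (rule infsum_cong_neutral) (auto simp: pull.rep_eq True)
  also have "\<dots> = (\<Sum>\<^sub>\<infinity>y\<in>\<phi> ` X. (cmod (ell2_fun f y))\<^sup>2)"
    using infsum_reindex[OF True, of "\<lambda>y. (cmod (ell2_fun f y))\<^sup>2"] by (simp add: comp_def)
  also have "\<dots> \<le> (norm f)\<^sup>2"
    unfolding norm_ell2_square by (rule infsum_mono2) (auto simp: ell2_summable)
  finally show ?thesis by (rule power2_le_imp_le) simp
next
  case False
  then have "pull X \<phi> f = 0" by (intro ell2_eqI) (simp add: pull.rep_eq zero_ell2.rep_eq)
  then show ?thesis by simp
qed

lemma bounded_linear_pull: "bounded_linear (pull X \<phi>)"
proof (rule bounded_linear_intro[where K = 1])
  fix f g :: "'a ell2" and r :: real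
  show "pull X \<phi> (f + g) = pull X \<phi> f + pull X \<phi> g" by transfer auto
  show "pull X \<phi> (r *\<^sub>R f) = r *\<^sub>R pull X \<phi> f" by transfer auto
  show "norm (pull X \<phi> f) \<le> norm f * 1" by (simp add: norm_pull_le)
qed

lemma pull_mult_i: "pull X \<phi> (ell2_mult_i f) = ell2_mult_i (pull X \<phi> f)"
  by transfer auto

text \<open>The composite may be given by any map \<open>\<theta>\<close> agreeing with it on
  \<open>X\<close>, so group laws valid only on the carrier can be used to rewrite it.\<close>

lemma pull_pull:
  assumes "inj_on \<phi> X" "inj_on \<psi> X" "\<phi> ` X \<subseteq> X" "\<And>x. x \<in> X \<Longrightarrow> \<theta> x = \<psi> (\<phi> x)"
  shows "pull X \<phi> (pull X \<psi> f) = pull X \<theta> f"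
proof -
  have "inj_on (\<psi> \<circ> \<phi>) X"
    by (rule comp_inj_on[OF assms(1) inj_on_subset[OF assms(2,3)]])
  then have inj: "inj_on \<theta> X"
    using inj_on_cong[of X \<theta> "\<psi> \<circ> \<phi>"] assms(4) by simp
  show ?thesis
  proof (rule ell2_eqI)
    fix x
    show "ell2_fun (pull X \<phi> (pull X \<psi> f)) x = ell2_fun (pull X \<theta> f) x"
      using assms inj by (cases "x \<in> X") (auto simp: pull.rep_eq)
  qed
qed

text \<open>Reindex the sum along the bijection. For shifts this says that the adjoint is the shift
  by the inverse.\<close>

lemma inner_pull:
  assumes "bij_betw \<phi> X X" "\<And>x. x \<in> X \<Longrightarrow> \<psi> (\<phi> x) = x"
  shows "pull X \<phi> f \<bullet> g = f \<bullet> pull X \<psi> g"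
proof -
  have inj: "inj_on \<phi> X" using assms(1) by (simp add: bij_betw_def)
  have inj': "inj_on \<psi> X"
    using assms by (metis (no_types, lifting) bij_betw_imp_surj_on image_iff inj_onI)
  have "(\<Sum>\<^sub>\<infinity>x. ell2_fun (pull X \<phi> f) x * cnj (ell2_fun g x)) =
      (\<Sum>\<^sub>\<infinity>x\<in>X. ell2_fun f (\<phi> x) * cnj (ell2_fun g (\<psi> (\<phi> x))))"
    by (rule infsum_cong_neutral) (auto simp: pull.rep_eq inj assms(2))
  also have "\<dots> = (\<Sum>\<^sub>\<infinity>y\<in>X. ell2_fun f y * cnj (ell2_fun g (\<psi> y)))"
    by (rule infsum_reindex_bij_betw[OF assms(1)])
  also have "\<dots> = (\<Sum>\<^sub>\<infinity>x. ell2_fun f x * cnj (ell2_fun (pull X \<psi> g) x))"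
    by (rule infsum_cong_neutral) (auto simp: pull.rep_eq inj')
  finally show ?thesis by (simp add: inner_ell2_def)
qed

lift_definition ell2_delta :: "'a \<Rightarrow> 'a ell2" is point_mass
proof -
  fix x :: 'a
  show "(\<lambda>y. (cmod (point_mass x y))\<^sup>2) summable_on UNIV"
    by (rule summable_on_cong_neutral[THEN iffD1, OF _ _ _ summable_on_finite[of "{x}"]])
       (auto simp: point_mass_def)
qed

lemma sum_mult_delta: "(\<Sum>\<^sub>\<infinity>y. ell2_fun f y * cnj (ell2_fun (ell2_delta x) y)) = ell2_fun f x"
proof -
  have "(\<Sum>\<^sub>\<infinity>y. ell2_fun f y * cnj (ell2_fun (ell2_delta x) y)) = (\<Sum>\<^sub>\<infinity>y\<in>{x}. ell2_fun f y)"
    by (rule infsum_cong_neutral) (auto simp: ell2_delta.rep_eq point_mass_def)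
  then show ?thesis by simp
qed

lemma inner_ell2_delta: "f \<bullet> ell2_delta x = Re (ell2_fun f x)"
  "f \<bullet> ell2_mult_i (ell2_delta x) = Im (ell2_fun f x)"
  by (simp add: inner_ell2_def sum_mult_delta, simp only: Im_ell2_sum sum_mult_delta)

section \<open>Shift operators and the Laplace operator\<close>

lemma pmf_has_sum_1: "set_pmf p \<subseteq> A \<Longrightarrow> (pmf p has_sum 1) A"
proof -
  assume A: "set_pmf p \<subseteq> A"
  have s: "(\<lambda>x. norm (pmf p x)) summable_on A"
    using pmf_abs_summable[of p A] unfolding abs_summable_equivalent[symmetric] .
  then have "infsum (pmf p) A = 1"
    using infsetsum_pmf_eq_1[OF A] infsetsum_infsum[OF pmf_abs_summable[of p A]] by simp
  then show ?thesis using abs_summable_summable[OF s] by (simp add: has_sum_iff)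
qed

text \<open>Finite partial sums are integrals of \<open>h\<close> cut off to a finite set, hence
  bounded by the full integral. This turns the second moment condition into a convergent series over
  the group.\<close>

lemma pmf_summable_on_integrable:
  assumes int: "integrable (measure_pmf p) h" and h: "\<And>x. 0 \<le> h x"
  shows "(\<lambda>x. pmf p x * h x) summable_on A"
proof (rule nonneg_bdd_above_summable_on)
  show "bdd_above (sum (\<lambda>x. pmf p x * h x) ` {F. F \<subseteq> A \<and> finite F})"
  proof (rule bdd_aboveI2)
    fix F assume "F \<in> {F. F \<subseteq> A \<and> finite F}"
    then have F: "finite F" by simp
    have "(\<Sum>x\<in>F. pmf p x * h x) = (\<Sum>x\<in>F. (h x * indicator F x) * pmf p x)"
      by (intro sum.cong) auto
    also have "\<dots> = (\<integral>x. h x * indicator F x \<partial>measure_pmf p)"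
      by (rule integral_measure_pmf_real[symmetric]) (use F in \<open>auto simp: indicator_def split: if_splits\<close>)
    also have "\<dots> \<le> (\<integral>x. h x \<partial>measure_pmf p)"
      by (intro integral_mono integrable_real_mult_indicator int) (auto simp: h indicator_def)
    finally show "(\<Sum>x\<in>F. pmf p x * h x) \<le> (\<integral>x. h x \<partial>measure_pmf p)" .
  qed
qed (simp add: h)

context group
begin

definition right_shift :: "'a \<Rightarrow> 'a ell2 \<Rightarrow> 'a ell2" where
  "right_shift g = pull (carrier G) (\<lambda>x. x \<otimes> inv g)"

definition left_shift :: "'a \<Rightarrow> 'a ell2 \<Rightarrow> 'a ell2" where
  "left_shift g = pull (carrier G) (\<lambda>x. inv g \<otimes> x)"

text \<open>The orthogonal projection onto the functions supported on the group. It takes the place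
  of the identity, being the right shift by the neutral element.\<close>

definition carrier_restrict :: "'a ell2 \<Rightarrow> 'a ell2" where
  "carrier_restrict = pull (carrier G) id"

lemma inv_mult_cancel: "g \<in> carrier G \<Longrightarrow> x \<in> carrier G \<Longrightarrow> inv g \<otimes> (g \<otimes> x) = x"
  "g \<in> carrier G \<Longrightarrow> x \<in> carrier G \<Longrightarrow> g \<otimes> (inv g \<otimes> x) = x"
  "g \<in> carrier G \<Longrightarrow> x \<in> carrier G \<Longrightarrow> x \<otimes> inv g \<otimes> g = x"
  "g \<in> carrier G \<Longrightarrow> x \<in> carrier G \<Longrightarrow> x \<otimes> g \<otimes> inv g = x"
  by (simp_all add: m_assoc flip: m_assoc[of "inv g" g x] m_assoc[of g "inv g" x])

lemma bij_right_mult: "g \<in> carrier G \<Longrightarrow> bij_betw (\<lambda>x. x \<otimes> inv g) (carrier G) (carrier G)"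
  by (rule bij_betw_byWitness[where f' = "\<lambda>x. x \<otimes> g"]) (auto simp: inv_mult_cancel)

lemma bij_left_mult: "g \<in> carrier G \<Longrightarrow> bij_betw (\<lambda>x. inv g \<otimes> x) (carrier G) (carrier G)"
  by (rule bij_betw_byWitness[where f' = "\<lambda>x. g \<otimes> x"]) (auto simp: inv_mult_cancel)

lemma bij_inv: "bij_betw (\<lambda>x. inv x) (carrier G) (carrier G)"
  by (rule bij_betw_byWitness[where f' = "\<lambda>x. inv x"]) auto

lemmas inj_mult = bij_right_mult[THEN bij_betw_imp_inj_on] bij_left_mult[THEN bij_betw_imp_inj_on]
  bij_inv[THEN bij_betw_imp_inj_on]

lemma bounded_linear_shifts: "bounded_linear (right_shift g)" "bounded_linear (left_shift g)"
  "bounded_linear carrier_restrict"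
  by (simp_all add: right_shift_def left_shift_def carrier_restrict_def bounded_linear_pull)

lemma shift_mult_i: "right_shift g (ell2_mult_i f) = ell2_mult_i (right_shift g f)"
  "left_shift g (ell2_mult_i f) = ell2_mult_i (left_shift g f)"
  "carrier_restrict (ell2_mult_i f) = ell2_mult_i (carrier_restrict f)"
  by (simp_all add: right_shift_def left_shift_def carrier_restrict_def pull_mult_i)

lemma restrict_restrict: "carrier_restrict (carrier_restrict f) = carrier_restrict f"
  unfolding carrier_restrict_def by (rule pull_pull) auto

lemma inner_restrict: "carrier_restrict f \<bullet> h = f \<bullet> carrier_restrict h"
  unfolding carrier_restrict_def by (rule inner_pull) auto

lemma ell2_fun_restrict: "ell2_fun (carrier_restrict f) x = (if x \<in> carrier G then ell2_fun f x else 0)"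
  by (simp add: carrier_restrict_def pull.rep_eq)

text \<open>The order is reversed because f is evaluated at x g^-1 h^-1 = x (h g)^-1.\<close>

lemma right_shift_mult:
  assumes "g \<in> carrier G" "h \<in> carrier G"
  shows "right_shift g (right_shift h f) = right_shift (h \<otimes> g) f"
  unfolding right_shift_def
  by (rule pull_pull) (use assms in \<open>auto simp: inj_mult inv_mult_group m_assoc\<close>)

lemma right_shift_one: "right_shift \<one> f = carrier_restrict f"
  by (rule ell2_eqI) (simp add: right_shift_def carrier_restrict_def pull.rep_eq inj_mult inj_on_def)

lemma right_shift_restrict:
  assumes "g \<in> carrier G"
  shows "right_shift g (carrier_restrict f) = right_shift g f" "carrier_restrict (right_shift g f) = right_shift g f"
  using right_shift_mult[of g \<one> f] right_shift_mult[of \<one> g f] assms by (simp_all add: right_shift_one)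

lemma left_right_shift:
  assumes "g \<in> carrier G" "h \<in> carrier G"
  shows "left_shift g (right_shift h f) = right_shift h (left_shift g f)"
  unfolding left_shift_def right_shift_def
  by (rule trans[OF pull_pull[where \<theta> = "\<lambda>x. inv g \<otimes> (x \<otimes> inv h)"] pull_pull[where \<theta> = "\<lambda>x. inv g \<otimes> (x \<otimes> inv h)", symmetric]])
     (use assms in \<open>auto simp: inj_mult m_assoc\<close>)

lemma inner_right_shift:
  assumes "g \<in> carrier G"
  shows "right_shift g f \<bullet> h = f \<bullet> right_shift (inv g) h"
  unfolding right_shift_def
  by (rule inner_pull) (use assms in \<open>auto simp: bij_right_mult inv_mult_cancel\<close>)

lemma inner_left_shift:
  assumes "g \<in> carrier G"
  shows "left_shift g f \<bullet> h = f \<bullet> left_shift (inv g) h"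
  unfolding left_shift_def
  by (rule inner_pull) (use assms in \<open>auto simp: bij_left_mult inv_mult_cancel\<close>)

lemma norm_right_shift:
  assumes "g \<in> carrier G"
  shows "norm (right_shift g f) = norm (carrier_restrict f)"
proof -
  have "right_shift g f \<bullet> right_shift g f = f \<bullet> carrier_restrict f"
    using assms by (simp add: inner_right_shift right_shift_mult right_shift_one)
  also have "\<dots> = carrier_restrict f \<bullet> carrier_restrict f"
    by (simp add: inner_restrict restrict_restrict)
  finally show ?thesis by (simp add: norm_eq_sqrt_inner)
qed

section \<open>Displacement of vectors and word length\<close>

definition displacement :: "'a ell2 \<Rightarrow> 'a \<Rightarrow> real" where
  "displacement f g = norm (right_shift g f - carrier_restrict f)"

lemma displacement_one: "displacement f \<one> = 0"
  by (simp add: displacement_def right_shift_one)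

text \<open>With R the right shift, split R_(hg) f - f into R_g (R_h f - f) and R_g f - f, up to
  restriction to the group, and use that R_g is isometric on functions supported there.\<close>

lemma displacement_mult:
  assumes "g \<in> carrier G" "h \<in> carrier G"
  shows "displacement f (h \<otimes> g) \<le> displacement f h + displacement f g"
proof -
  note lin = bounded_linear.linear[OF bounded_linear_shifts(1)] bounded_linear.linear[OF bounded_linear_shifts(3)]
  have "right_shift (h \<otimes> g) f - carrier_restrict f =
     right_shift g (right_shift h f - f) + (right_shift g f - carrier_restrict f)"
    using assms by (simp add: right_shift_mult[symmetric] linear_diff[OF lin(1)])
  then have "displacement f (h \<otimes> g) \<le> norm (right_shift g (right_shift h f - f)) + displacement f g"
    unfolding displacement_def by (metis norm_triangle_ineq)
  also have "norm (right_shift g (right_shift h f - f)) = displacement f h"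
    using assms by (simp add: norm_right_shift linear_diff[OF lin(2)] right_shift_restrict displacement_def)
  finally show ?thesis .
qed

lemma displacement_inv:
  assumes "g \<in> carrier G"
  shows "displacement f (inv g) = displacement f g"
proof -
  note lin = bounded_linear.linear[OF bounded_linear_shifts(1)] bounded_linear.linear[OF bounded_linear_shifts(3)]
  have "right_shift (inv g) f - carrier_restrict f = right_shift (inv g) (f - right_shift g f)"
    using assms by (simp add: linear_diff[OF lin(1)] right_shift_mult right_shift_one)
  then have "displacement f (inv g) = norm (carrier_restrict f - right_shift g f)"
    using assms by (simp add: displacement_def norm_right_shift linear_diff[OF lin(2)] right_shift_restrict)
  then show ?thesis by (simp add: displacement_def norm_minus_commute)
qed

lemma foldr_mult_append:
  assumes "set us \<subseteq> carrier G" "set ws \<subseteq> carrier G"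
  shows "foldr (\<otimes>) ws \<one> \<in> carrier G"
    "foldr (\<otimes>) (us @ ws) \<one> = foldr (\<otimes>) us \<one> \<otimes> foldr (\<otimes>) ws \<one>"
proof -
  show *: "foldr (\<otimes>) ws \<one> \<in> carrier G" using assms(2) by (induction ws) auto
  have "foldr (\<otimes>) us \<one> \<in> carrier G \<and> foldr (\<otimes>) (us @ ws) \<one> = foldr (\<otimes>) us \<one> \<otimes> foldr (\<otimes>) ws \<one>"
    using assms(1) * by (induction us) (auto simp: m_assoc)
  then show "foldr (\<otimes>) (us @ ws) \<one> = foldr (\<otimes>) us \<one> \<otimes> foldr (\<otimes>) ws \<one>" by simp
qed

lemma generate_imp_word:
  assumes "g \<in> generate G S" "S \<subseteq> carrier G"
  shows "\<exists>ws. set ws \<subseteq> S \<union> (\<lambda>s. inv s) ` S \<and> foldr (\<otimes>) ws \<one> = g"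
  using assms(1)
proof induction
  case one
  then show ?case by (intro exI[of _ "[]"]) simp
next
  case (incl h)
  then show ?case using assms(2) by (intro exI[of _ "[h]"]) auto
next
  case (inv h)
  then show ?case using assms(2) by (intro exI[of _ "[inv h]"]) auto
next
  case (eng h1 h2)
  then obtain us ws where "set us \<subseteq> S \<union> (\<lambda>s. inv s) ` S" "foldr (\<otimes>) us \<one> = h1"
    "set ws \<subseteq> S \<union> (\<lambda>s. inv s) ` S" "foldr (\<otimes>) ws \<one> = h2" by blast
  moreover have "S \<union> (\<lambda>s. inv s) ` S \<subseteq> carrier G" using assms(2) by auto
  ultimately have "foldr (\<otimes>) (us @ ws) \<one> = h1 \<otimes> h2 \<and> set (us @ ws) \<subseteq> S \<union> (\<lambda>s. inv s) ` S"
    using foldr_mult_append(2)[of us ws] by (metis Un_least order_trans set_append)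
  then show ?case by blast
qed

lemma displacement_le_word_length:
  assumes S: "finite_generating_set G S" and g: "g \<in> carrier G"
  shows "displacement f g \<le> real (word_length G S g) * (\<Sum>s\<in>S. displacement f s)"
proof -
  have S': "finite S" "S \<subseteq> carrier G" "g \<in> generate G S"
    using S g by (auto simp: finite_generating_set_def)
  \<comment> \<open>The quantifiers are shaped like the \<open>LEAST\<close> in
    \<open>word_length\<close>, so \<open>LeastI_ex\<close> returns a word of minimal
    length.\<close>
  have "\<exists>n ws. length ws = n \<and> set ws \<subseteq> S \<union> (\<lambda>s. inv s) ` S \<and> foldr (\<otimes>) ws \<one> = g"
    using generate_imp_word[OF S'(3,2)] by blast
  from LeastI_ex[OF this] obtain ws where ws: "length ws = word_length G S g"
    "set ws \<subseteq> S \<union> (\<lambda>s. inv s) ` S" "foldr (\<otimes>) ws \<one> = g"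
    unfolding word_length_def by blast
  \<comment> \<open>Displacement is invariant under inversion, so inverted generators are covered as
    well; the sum over \<open>S\<close> is a common bound for all letters.\<close>
  have letter: "a \<in> carrier G \<and> displacement f a \<le> (\<Sum>s\<in>S. displacement f s)"
    if a: "a \<in> S \<union> (\<lambda>s. inv s) ` S" for a
  proof -
    obtain s where s: "s \<in> S" "a = s \<or> a = inv s" using a by blast
    then have "displacement f a = displacement f s" using displacement_inv S'(2) by auto
    moreover have "displacement f s \<le> (\<Sum>s\<in>S. displacement f s)"
      by (rule member_le_sum) (use s S'(1) in \<open>auto simp: displacement_def\<close>)
    ultimately show ?thesis using s S'(2) by auto
  qed
  have "foldr (\<otimes>) ws \<one> \<in> carrier G \<and>
     displacement f (foldr (\<otimes>) ws \<one>) \<le> real (length ws) * (\<Sum>s\<in>S. displacement f s)"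
    using ws(2)
  proof (induction ws)
    case Nil
    then show ?case by (simp add: displacement_one)
  next
    case (Cons a ws)
    then have a: "a \<in> carrier G" "displacement f a \<le> (\<Sum>s\<in>S. displacement f s)" using letter by auto
    have IH: "foldr (\<otimes>) ws \<one> \<in> carrier G"
      "displacement f (foldr (\<otimes>) ws \<one>) \<le> real (length ws) * (\<Sum>s\<in>S. displacement f s)"
      using Cons by auto
    show ?case
      using displacement_mult[OF IH(1) a(1), of f] a IH by (simp add: distrib_right)
  qed
  then show ?thesis using ws by simp
qed

section \<open>The trace property of equivariant operators\<close>

text \<open>
  The trace property rests on the fact that the conjugate flip sends \<open>B \<delta>\<close> to \<open>B\<^sup>* \<delta>\<close> for every
  equivariant operator \<open>B\<close>.
\<close>

definition flip :: "'a ell2 \<Rightarrow> 'a ell2" where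
  "flip f = ell2_cnj (pull (carrier G) (\<lambda>x. inv x) f)"

lemma inner_flip: "flip f \<bullet> flip h = f \<bullet> carrier_restrict h"
proof -
  have "flip f \<bullet> flip h = f \<bullet> pull (carrier G) (\<lambda>x. inv x) (pull (carrier G) (\<lambda>x. inv x) h)"
    unfolding flip_def inner_ell2_cnj by (rule inner_pull) (auto simp: bij_inv)
  also have "pull (carrier G) (\<lambda>x. inv x) (pull (carrier G) (\<lambda>x. inv x) h) = carrier_restrict h"
    unfolding carrier_restrict_def by (rule pull_pull) (auto simp: inj_mult)
  finally show ?thesis .
qed

lemma left_shift_delta:
  assumes "g \<in> carrier G"
  shows "left_shift g (ell2_delta \<one>) = ell2_delta g"
proof (rule ell2_eqI)
  fix x
  have "inv g \<otimes> x = \<one> \<longleftrightarrow> x = g" if "x \<in> carrier G"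
    using assms that by (metis inv_closed inv_mult_cancel(2) l_inv r_one)
  then show "ell2_fun (left_shift g (ell2_delta \<one>)) x = ell2_fun (ell2_delta g) x"
    using assms by (auto simp: left_shift_def pull.rep_eq inj_mult ell2_delta.rep_eq point_mass_def)
qed

lemma restrict_delta: "carrier_restrict (ell2_delta \<one>) = ell2_delta \<one>"
  by (rule ell2_eqI) (auto simp: ell2_fun_restrict ell2_delta.rep_eq point_mass_def)

text \<open>Besides commutation with left translations, multiplication by i encodes complex
  linearity on a real space, and the restriction makes the operator respect the splitting of a
  function into its parts on and off the group.\<close>

definition equivariant :: "('a ell2 \<Rightarrow> 'a ell2) \<Rightarrow> bool" where
  "equivariant B \<longleftrightarrow> (\<forall>f. B (ell2_mult_i f) = ell2_mult_i (B f)) \<and>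
     (\<forall>f. B (carrier_restrict f) = carrier_restrict (B f)) \<and>
     (\<forall>g\<in>carrier G. \<forall>f. B (left_shift g f) = left_shift g (B f))"

text \<open>With L the left shift and delta the point mass at the neutral element, <B delta,
  L_(x^-1) delta> = <B L_x delta, delta> = <L_x delta, B' delta>. So the conjugate of B delta at
  x^-1 is B' delta at x. The imaginary part is obtained by testing against i times a point
  mass.\<close>

lemma flip_equivariant_delta:
  assumes B: "equivariant B" and adj: "\<And>f h. B f \<bullet> h = f \<bullet> B' h"
  shows "flip (B (ell2_delta \<one>)) = carrier_restrict (B' (ell2_delta \<one>))"
proof (rule ell2_eqI)
  fix x
  let ?d = "ell2_delta \<one> :: 'a ell2" and ?J = "ell2_mult_i :: 'a ell2 \<Rightarrow> _"
  have "cnj (ell2_fun (B ?d) (inv x)) = ell2_fun (B' ?d) x" if x: "x \<in> carrier G"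
  proof (rule complex_eqI)
    have "Re (ell2_fun (B ?d) (inv x)) = B ?d \<bullet> left_shift (inv x) ?d"
      using x by (simp add: left_shift_delta inner_ell2_delta)
    also have "\<dots> = B (left_shift x ?d) \<bullet> ?d"
      using x B inner_left_shift[of x "B ?d" ?d] by (simp add: equivariant_def)
    also have "\<dots> = B' ?d \<bullet> ell2_delta x"
      using x adj[of "ell2_delta x" ?d] inner_commute[of "B' ?d" "ell2_delta x"]
      by (simp add: left_shift_delta)
    finally show "Re (cnj (ell2_fun (B ?d) (inv x))) = Re (ell2_fun (B' ?d) x)"
      by (simp add: inner_ell2_delta)
    have "Im (ell2_fun (B ?d) (inv x)) = B ?d \<bullet> ?J (left_shift (inv x) ?d)"
      using x by (simp add: left_shift_delta inner_ell2_delta)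
    also have "\<dots> = - (?J (B ?d) \<bullet> left_shift (inv x) ?d)" by (rule inner_ell2_mult_i_right)
    also have "\<dots> = - (B (left_shift x (?J ?d)) \<bullet> ?d)"
      using x B inner_left_shift[of x "?J (B ?d)" ?d] by (simp add: equivariant_def)
    also have "\<dots> = - (B' ?d \<bullet> ?J (ell2_delta x))"
      using x adj[of "?J (ell2_delta x)" ?d] inner_commute[of "B' ?d" "?J (ell2_delta x)"]
      by (simp add: left_shift_delta shift_mult_i)
    finally show "Im (cnj (ell2_fun (B ?d) (inv x))) = Im (ell2_fun (B' ?d) x)"
      by (simp add: inner_ell2_delta)
  qed
  then show "ell2_fun (flip (B ?d)) x = ell2_fun (carrier_restrict (B' ?d)) x"
    by (auto simp: flip_def ell2_cnj.rep_eq pull.rep_eq inj_mult ell2_fun_restrict)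
qed

text \<open>The left side is <B delta, A delta>. The conjugate flip preserves this product of
  functions on the group and turns it into <B' delta, A delta>; moving B' back across gives the
  right side.\<close>

lemma trace_commute:
  assumes A: "symmetric_op A" "equivariant A"
    and B: "equivariant B" "\<And>f h. B f \<bullet> h = f \<bullet> B' h"
  shows "A (B (ell2_delta \<one>)) \<bullet> ell2_delta \<one> = B (A (ell2_delta \<one>)) \<bullet> ell2_delta \<one>"
proof -
  let ?d = "ell2_delta \<one> :: 'a ell2"
  have "carrier_restrict (A ?d) = A ?d" using A(2) restrict_delta by (metis equivariant_def)
  note fl = flip_equivariant_delta[OF B] flip_equivariant_delta[OF A(2) symmetric_opD(3)[OF A(1)]]
  have "A (B ?d) \<bullet> ?d = B ?d \<bullet> A ?d" by (rule symmetric_opD(3)[OF A(1)])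
  also have "\<dots> = flip (B ?d) \<bullet> flip (A ?d)"
    unfolding inner_flip using \<open>carrier_restrict (A ?d) = A ?d\<close> by simp
  also have "\<dots> = B' ?d \<bullet> A ?d"
    unfolding fl inner_restrict restrict_restrict using \<open>carrier_restrict (A ?d) = A ?d\<close> by simp
  also have "\<dots> = B (A ?d) \<bullet> ?d" using B(2)[of "A ?d" ?d] by (simp add: inner_commute)
  finally show ?thesis .
qed

lemma equivariant_projection_trace_le:
  assumes P: "orth_projection P" "equivariant P" and Q: "orth_projection Q" "equivariant Q"
    and inj: "\<And>f. P f = f \<Longrightarrow> Q f = 0 \<Longrightarrow> f = 0"
  shows "P (ell2_delta \<one>) \<bullet> ell2_delta \<one> \<le> Q (ell2_delta \<one>) \<bullet> ell2_delta \<one>"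
proof (rule projection_inner_le[OF P(1) Q(1) inj])
  fix k :: nat assume k: "0 < k"
  let ?d = "ell2_delta \<one> :: 'a ell2"
  note P' = orth_projectionD[OF P(1)] and Q' = orth_projectionD[OF Q(1)]
  \<comment> \<open>With B = (QP)^k one has (PQP)^k = P B and (QPQ)^k = B Q, while B P = B = Q B
    because k > 0. The trace property for the pairs P, B and Q, B identifies both values with that
    of B.\<close>
  define B where "B = (\<lambda>f. Q (P f)) ^^ k"
  define B' where "B' = (\<lambda>f. P (Q f)) ^^ k"
  obtain j where j: "k = Suc j" using k gr0_conv_Suc by blast
  have "((\<lambda>f. Q (P f)) ^^ n) f \<bullet> h = f \<bullet> ((\<lambda>f. P (Q f)) ^^ n) h" for n f h
  proof (induction n arbitrary: h)
    case (Suc n)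
    have "((\<lambda>f. Q (P f)) ^^ Suc n) f \<bullet> h = f \<bullet> ((\<lambda>f. P (Q f)) ^^ n) (P (Q h))"
      by (simp add: P'(4) Q'(4) Suc)
    then show ?case by (simp add: funpow_Suc_right del: funpow.simps(2))
  qed simp
  then have adj: "B f \<bullet> h = f \<bullet> B' h" for f h by (simp add: B_def B'_def)
  have "equivariant ((\<lambda>f. Q (P f)) ^^ n)" for n
    using P(2) Q(2) by (induction n) (auto simp: equivariant_def)
  then have eqB: "equivariant B" by (simp add: B_def)
  have PB: "((\<lambda>f. P (Q (P f))) ^^ Suc n) f = P (((\<lambda>f. Q (P f)) ^^ Suc n) f)" for n f
    by (induction n) (simp_all add: P'(5))
  have QB: "((\<lambda>f. Q (P (Q f))) ^^ Suc n) f = ((\<lambda>f. Q (P f)) ^^ Suc n) (Q f)" for n f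
    by (induction n) (simp_all add: Q'(5))
  have "B (P f) = B f" for f
    unfolding B_def j funpow_Suc_right by (simp add: P'(5))
  moreover have "Q (B f) = B f" for f unfolding B_def j by (simp add: Q'(5))
  ultimately have "P (B ?d) \<bullet> ?d = B (Q ?d) \<bullet> ?d"
    using trace_commute[OF P'(1) P(2) eqB adj] trace_commute[OF Q'(1) Q(2) eqB adj] by simp
  then show "((\<lambda>f. P (Q (P f))) ^^ k) ?d \<bullet> ?d = ((\<lambda>f. Q (P (Q f))) ^^ k) ?d \<bullet> ?d"
    using PB[of j ?d] QB[of j ?d] by (simp add: B_def j)
qed

end

section \<open>The Laplace operator of a symmetric measure and its quadratic form\<close>

text \<open>
  Functions on the group are functions on the whole type; the shifts annihilate the functions
  supported off the carrier, so the operator \<open>laplace\<close> below is the identity on those.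
\<close>

locale symmetric_walk = group +
  fixes \<mu> :: "'a pmf"
  assumes supp: "set_pmf \<mu> \<subseteq> carrier G"
    and sym: "\<And>g. g \<in> carrier G \<Longrightarrow> pmf \<mu> (inv g) = pmf \<mu> g"
begin

definition markov :: "'a ell2 \<Rightarrow> 'a ell2" where
  "markov f = (\<Sum>\<^sub>\<infinity>g\<in>carrier G. pmf \<mu> g *\<^sub>R right_shift g f)"

definition laplace :: "'a ell2 \<Rightarrow> 'a ell2" where
  "laplace f = f - markov f"

lemma norm_markov_term: "norm (pmf \<mu> g *\<^sub>R right_shift g f) \<le> pmf \<mu> g * norm f"
  by (simp add: right_shift_def norm_pull_le mult_left_mono)

lemma norm_markov_summable: "(\<lambda>g. norm (pmf \<mu> g *\<^sub>R right_shift g f)) summable_on carrier G"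
proof -
  have "(\<lambda>g. pmf \<mu> g * norm f) summable_on carrier G"
    using pmf_has_sum_1[OF supp] by (intro summable_on_cmult_left) (auto simp: has_sum_iff)
  then show ?thesis
    by (rule summable_on_comparison_nonneg) (auto intro: norm_markov_term simp del: norm_scaleR)
qed

lemma markov_has_sum: "((\<lambda>g. pmf \<mu> g *\<^sub>R right_shift g f) has_sum markov f) (carrier G)"
  unfolding markov_def by (rule has_sum_infsum[OF abs_summable_summable[OF norm_markov_summable]])

lemma markov_bounded_linear_has_sum:
  assumes "bounded_linear B"
  shows "((\<lambda>g. pmf \<mu> g *\<^sub>R B (right_shift g f)) has_sum B (markov f)) (carrier G)"
  using has_sum_bounded_linear[OF assms markov_has_sum[of f]]
  by (simp add: linear_scale[OF bounded_linear.linear[OF assms]])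

lemma norm_markov_le: "norm (markov f) \<le> norm f"
proof -
  have bound: "((\<lambda>g. pmf \<mu> g * norm f) has_sum 1 * norm f) (carrier G)"
    by (rule has_sum_cmult_left[OF pmf_has_sum_1[OF supp]])
  have "((\<lambda>g. norm (pmf \<mu> g *\<^sub>R right_shift g f)) has_sum
      (\<Sum>\<^sub>\<infinity>g\<in>carrier G. norm (pmf \<mu> g *\<^sub>R right_shift g f))) (carrier G)" (is "(_ has_sum ?s) _")
    by (intro has_sum_infsum norm_markov_summable)
  then have "norm (markov f) \<le> ?s" "?s \<le> 1 * norm f"
    by (rule norm_has_sum_bound[OF _ markov_has_sum], rule has_sum_mono[OF _ bound norm_markov_term])
  then show ?thesis by simp
qed

lemma bounded_linear_markov: "bounded_linear markov"
proof (rule bounded_linear_intro[where K = 1])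
  fix f h :: "'a ell2" and r :: real
  note lin = bounded_linear.linear[OF bounded_linear_shifts(1)]
  have "((\<lambda>g. pmf \<mu> g *\<^sub>R right_shift g (f + h)) has_sum (markov f + markov h)) (carrier G)"
    using has_sum_add[OF markov_has_sum[of f] markov_has_sum[of h]]
    by (simp add: linear_add[OF lin] scaleR_add_right)
  then show "markov (f + h) = markov f + markov h" by (rule has_sum_unique[OF markov_has_sum])
  have "((\<lambda>g. pmf \<mu> g *\<^sub>R right_shift g (r *\<^sub>R f)) has_sum (r *\<^sub>R markov f)) (carrier G)"
    using has_sum_scaleR[OF markov_has_sum[of f], of r]
    by (simp add: linear_scale[OF lin] mult.commute)
  then show "markov (r *\<^sub>R f) = r *\<^sub>R markov f" by (rule has_sum_unique[OF markov_has_sum])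
  show "norm (markov f) \<le> norm f * 1" by (simp add: norm_markov_le)
qed

lemma markov_commute:
  assumes "bounded_linear B" "\<And>g f. g \<in> carrier G \<Longrightarrow> B (right_shift g f) = right_shift g (B f)"
  shows "B (markov f) = markov (B f)"
proof -
  have "((\<lambda>g. pmf \<mu> g *\<^sub>R right_shift g (B f)) has_sum B (markov f)) (carrier G)"
    using markov_bounded_linear_has_sum[OF assms(1), of f] assms(2)
    by (subst has_sum_cong[of _ _ "\<lambda>g. pmf \<mu> g *\<^sub>R B (right_shift g f)"]) auto
  then show ?thesis using has_sum_unique markov_has_sum by blast
qed

lemma inner_markov_has_sum:
  "((\<lambda>g. pmf \<mu> g * (right_shift g f \<bullet> h)) has_sum (markov f \<bullet> h)) (carrier G)"
  using markov_bounded_linear_has_sum[OF bounded_linear_inner_left[of h], of f] by simp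

text \<open>Reindex by inversion, which preserves the weights and turns each right shift into its
  adjoint.\<close>

lemma markov_symmetric: "markov f \<bullet> h = f \<bullet> markov h"
proof -
  have "((\<lambda>g. pmf \<mu> g * (right_shift g f \<bullet> h)) has_sum (markov h \<bullet> f)) (carrier G)"
  proof -
    have "((\<lambda>g. pmf \<mu> g * (right_shift g h \<bullet> f)) has_sum (markov h \<bullet> f)) ((\<lambda>g. inv g) ` carrier G)"
      using inner_markov_has_sum[of h f] bij_inv by (simp add: bij_betw_def)
    then have "(((\<lambda>g. pmf \<mu> g * (right_shift g h \<bullet> f)) \<circ> (\<lambda>g. inv g)) has_sum (markov h \<bullet> f)) (carrier G)"
      using has_sum_reindex[OF inj_mult(3)] by blast
    then show ?thesis
    proof (rule has_sum_cong[THEN iffD1, rotated])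
      fix g assume g: "g \<in> carrier G"
      have "right_shift (inv g) h \<bullet> f = right_shift g f \<bullet> h"
        using inner_right_shift[of "inv g" h f] g by (simp add: inner_commute)
      then show "((\<lambda>g. pmf \<mu> g * (right_shift g h \<bullet> f)) \<circ> (\<lambda>g. inv g)) g = pmf \<mu> g * (right_shift g f \<bullet> h)"
        using g by (simp add: sym)
    qed
  qed
  then have "markov f \<bullet> h = markov h \<bullet> f" using has_sum_unique inner_markov_has_sum by blast
  then show ?thesis by (simp add: inner_commute)
qed

lemma symmetric_op_laplace: "symmetric_op laplace"
proof -
  have "bounded_linear laplace"
    unfolding laplace_def[abs_def] by (intro bounded_linear_sub bounded_linear_ident bounded_linear_markov)
  moreover have "laplace f \<bullet> h = f \<bullet> laplace h" for f h
    using markov_symmetric[of f h] by (simp add: laplace_def inner_diff_left inner_diff_right)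
  ultimately show ?thesis by (simp add: symmetric_op_def)
qed

lemma laplace_bounds: "0 \<le> laplace f \<bullet> f" "laplace f \<bullet> f \<le> 2 * (f \<bullet> f)"
proof -
  have "\<bar>markov f \<bullet> f\<bar> \<le> norm (markov f) * norm f" by (rule Cauchy_Schwarz_ineq2)
  also have "\<dots> \<le> norm f * norm f" by (intro mult_right_mono norm_markov_le) simp
  also have "\<dots> = f \<bullet> f" by (simp add: dot_square_norm power2_eq_square)
  finally show "0 \<le> laplace f \<bullet> f" "laplace f \<bullet> f \<le> 2 * (f \<bullet> f)"
    by (auto simp: laplace_def inner_diff_left)
qed

lemma laplace_commute:
  assumes "bounded_linear B" "\<And>g f. g \<in> carrier G \<Longrightarrow> B (right_shift g f) = right_shift g (B f)"
  shows "B (laplace f) = laplace (B f)"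
  using markov_commute[OF assms] linear_diff[OF bounded_linear.linear[OF assms(1)]]
  by (simp add: laplace_def)

text \<open>Multiplication by i, the restriction and all left translations commute with the right
  shifts, hence with \<open>laplace\<close>. Whatever commutes with the bounded commutant of
  \<open>laplace\<close>, as its spectral projections do, is therefore equivariant.\<close>

lemma equivariant_if_commutes:
  assumes "\<And>B f. bounded_linear B \<Longrightarrow> \<forall>f. B (laplace f) = laplace (B f) \<Longrightarrow> B (P f) = P (B f)"
  shows "equivariant P"
  unfolding equivariant_def
proof (intro conjI allI ballI)
  fix f
  show "P (ell2_mult_i f) = ell2_mult_i (P f)"
    by (intro assms[symmetric] allI laplace_commute bounded_linear_ell2_mult_i) (simp add: shift_mult_i)
  show "P (carrier_restrict f) = carrier_restrict (P f)"
    by (intro assms[symmetric] allI laplace_commute bounded_linear_shifts) (simp add: right_shift_restrict)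
  show "P (left_shift g f) = left_shift g (P f)" if "g \<in> carrier G" for g
    by (intro assms[symmetric] allI laplace_commute bounded_linear_shifts) (simp add: left_right_shift that)
qed

lemma equivariant_laplace: "equivariant laplace"
  by (rule equivariant_if_commutes) blast

text \<open>On the group the squared displacement expands to 2 |f|^2 - 2 <R_g f, f>, with R the
  right shift, and the weights sum to 1. Off the group \<open>laplace\<close> is the identity, which
  accounts for the subtracted square.\<close>

lemma laplace_form_has_sum:
  "((\<lambda>g. pmf \<mu> g * (displacement f g)\<^sup>2) has_sum 2 * (laplace f \<bullet> f - (norm (f - carrier_restrict f))\<^sup>2)) (carrier G)"
proof -
  have "carrier_restrict f \<bullet> carrier_restrict f = carrier_restrict f \<bullet> f"
    using inner_restrict[of f "carrier_restrict f"] by (simp add: restrict_restrict inner_commute)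
  then have split: "(norm (f - carrier_restrict f))\<^sup>2 = f \<bullet> f - (norm (carrier_restrict f))\<^sup>2"
    by (simp add: power2_norm_eq_inner inner_diff_left inner_diff_right inner_commute)
  have disp: "(displacement f g)\<^sup>2 = 2 * (norm (carrier_restrict f))\<^sup>2 - 2 * (right_shift g f \<bullet> f)"
    if g: "g \<in> carrier G" for g
  proof -
    have "right_shift g f \<bullet> carrier_restrict f = right_shift g f \<bullet> f"
      using inner_restrict[of "right_shift g f" f] g by (simp add: right_shift_restrict)
    moreover have "right_shift g f \<bullet> right_shift g f = carrier_restrict f \<bullet> carrier_restrict f"
      using norm_right_shift[OF g, of f] by (simp add: norm_eq_sqrt_inner)
    ultimately show ?thesis
      by (simp add: displacement_def power2_norm_eq_inner inner_diff_left inner_diff_right inner_commute)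
  qed
  have "((\<lambda>g. pmf \<mu> g * (2 * (norm (carrier_restrict f))\<^sup>2) + pmf \<mu> g * (right_shift g f \<bullet> f) * (- 2))
     has_sum 1 * (2 * (norm (carrier_restrict f))\<^sup>2) + markov f \<bullet> f * (- 2)) (carrier G)"
    by (intro has_sum_add has_sum_cmult_left pmf_has_sum_1 supp inner_markov_has_sum)
  then have "((\<lambda>g. pmf \<mu> g * (displacement f g)\<^sup>2)
     has_sum 1 * (2 * (norm (carrier_restrict f))\<^sup>2) + markov f \<bullet> f * (- 2)) (carrier G)"
    by (rule has_sum_cong[THEN iffD1, rotated]) (simp add: disp algebra_simps)
  then show ?thesis by (simp add: split laplace_def inner_diff_left algebra_simps)
qed

lemma laplace_form_ge: "(norm (f - carrier_restrict f))\<^sup>2 \<le> laplace f \<bullet> f"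
proof -
  have "0 \<le> 2 * (laplace f \<bullet> f - (norm (f - carrier_restrict f))\<^sup>2)"
    by (rule has_sum_nonneg[OF laplace_form_has_sum]) simp
  then show ?thesis by simp
qed

text \<open>A single term of a nonnegative series is at most its sum. The weight of \<open>s\<close>
  is positive, so the estimate can be solved for the displacement.\<close>

lemma displacement_le_form:
  assumes "s \<in> set_pmf \<mu>"
  shows "displacement f s \<le> sqrt (2 / pmf \<mu> s) * sqrt (laplace f \<bullet> f - (norm (f - carrier_restrict f))\<^sup>2)"
proof -
  have s: "s \<in> carrier G" "pmf \<mu> s > 0" using assms supp by (auto simp: pmf_positive)
  have "(\<Sum>g\<in>{s}. pmf \<mu> g * (displacement f g)\<^sup>2) \<le> 2 * (laplace f \<bullet> f - (norm (f - carrier_restrict f))\<^sup>2)"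
    by (rule finite_sum_le_has_sum[OF laplace_form_has_sum]) (use s in auto)
  then have "(displacement f s)\<^sup>2 \<le> (2 / pmf \<mu> s) * (laplace f \<bullet> f - (norm (f - carrier_restrict f))\<^sup>2)"
    using s by (simp add: field_simps)
  then show ?thesis using real_le_rsqrt by (simp add: real_sqrt_mult[symmetric])
qed

end

section \<open>Spectral distributions\<close>

lemma (in group) admissible_symmetric_walk: "admissible G \<mu> \<Longrightarrow> symmetric_walk G \<mu>"
  unfolding admissible_def symmetric_walk_def symmetric_walk_axioms_def by (metis is_group)

lemma (in group) laplace_form_comparison:
  assumes \<mu>: "admissible G \<mu>" and \<nu>: "admissible G \<nu>"
  obtains C where "C > 0"
    "\<And>f. symmetric_walk.laplace G \<mu> f \<bullet> f \<le> C * (symmetric_walk.laplace G \<nu> f \<bullet> f)"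
proof -
  interpret M: symmetric_walk G \<mu> by (rule admissible_symmetric_walk[OF \<mu>])
  interpret N: symmetric_walk G \<nu> by (rule admissible_symmetric_walk[OF \<nu>])
  obtain S where S: "finite_generating_set G S"
    "integrable (measure_pmf \<mu>) (\<lambda>g. (real (word_length G S g))\<^sup>2)"
    using \<mu> by (auto simp: admissible_def)
  obtain T where T: "finite_generating_set G T" "T \<subseteq> set_pmf \<nu>"
    using \<nu> by (auto simp: admissible_def)
  \<comment> \<open>The set \<open>S\<close> on which the second moment of \<mu> is finite need not
    lie in the support of \<nu>. The first factor pays for writing its elements as words over
    \<open>T\<close>, the second for bounding displacements along \<open>T\<close> by the form of
    \<nu>.\<close>
  define K where "K = (\<Sum>s\<in>S. real (word_length G T s)) * (\<Sum>t\<in>T. sqrt (2 / pmf \<nu> t))"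
  define m where "m = (\<Sum>\<^sub>\<infinity>g\<in>carrier G. pmf \<mu> g * (real (word_length G S g))\<^sup>2)"
  have m: "((\<lambda>g. pmf \<mu> g * (real (word_length G S g))\<^sup>2) has_sum m) (carrier G)"
    unfolding m_def by (intro has_sum_infsum pmf_summable_on_integrable S(2)) simp
  have m0: "0 \<le> m" by (rule has_sum_nonneg[OF m]) simp
  \<comment> \<open>The summand 1 absorbs the part off the group, on which both Laplace operators
    are the identity, and keeps \<open>C\<close> positive.\<close>
  define C where "C = 1 + K\<^sup>2 * m"
  have "M.laplace f \<bullet> f \<le> C * (N.laplace f \<bullet> f)" for f
  proof -
    define r where "r = (norm (f - carrier_restrict f))\<^sup>2"
    define q where "q = N.laplace f \<bullet> f - r"
    have q0: "0 \<le> q" using N.laplace_form_ge[of f] by (simp add: q_def r_def)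
    have "(\<Sum>t\<in>T. displacement f t) \<le> (\<Sum>t\<in>T. sqrt (2 / pmf \<nu> t) * sqrt q)"
      by (rule sum_mono) (use N.displacement_le_form[of _ f] T(2) in \<open>auto simp: q_def r_def\<close>)
    then have dT: "(\<Sum>t\<in>T. displacement f t) \<le> (\<Sum>t\<in>T. sqrt (2 / pmf \<nu> t)) * sqrt q"
      by (simp add: sum_distrib_right)
    have "(\<Sum>s\<in>S. displacement f s) \<le> (\<Sum>s\<in>S. real (word_length G T s) * (\<Sum>t\<in>T. displacement f t))"
      by (rule sum_mono, rule displacement_le_word_length[OF T(1)])
         (use S(1) in \<open>auto simp: finite_generating_set_def\<close>)
    also have "\<dots> = (\<Sum>s\<in>S. real (word_length G T s)) * (\<Sum>t\<in>T. displacement f t)"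
      by (simp add: sum_distrib_right)
    also have "\<dots> \<le> (\<Sum>s\<in>S. real (word_length G T s)) * ((\<Sum>t\<in>T. sqrt (2 / pmf \<nu> t)) * sqrt q)"
      by (intro mult_left_mono dT sum_nonneg) simp
    finally have dS: "(\<Sum>s\<in>S. displacement f s) \<le> K * sqrt q" by (simp add: K_def mult.assoc)
    have "pmf \<mu> g * (displacement f g)\<^sup>2 \<le> pmf \<mu> g * (real (word_length G S g))\<^sup>2 * (K\<^sup>2 * q)"
      if g: "g \<in> carrier G" for g
    proof -
      have "displacement f g \<le> real (word_length G S g) * (K * sqrt q)"
        using displacement_le_word_length[OF S(1) g, of f]
        by (rule order_trans) (intro mult_left_mono dS, simp)
      then have "(displacement f g)\<^sup>2 \<le> (real (word_length G S g) * (K * sqrt q))\<^sup>2"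
        by (intro power_mono) (auto simp: displacement_def)
      then have "(displacement f g)\<^sup>2 \<le> (real (word_length G S g))\<^sup>2 * (K\<^sup>2 * q)"
        using q0 by (simp add: power_mult_distrib)
      then have "pmf \<mu> g * (displacement f g)\<^sup>2 \<le> pmf \<mu> g * ((real (word_length G S g))\<^sup>2 * (K\<^sup>2 * q))"
        by (intro mult_left_mono) auto
      then show ?thesis by (simp add: mult.assoc)
    qed
    then have "2 * (M.laplace f \<bullet> f - r) \<le> m * (K\<^sup>2 * q)"
      unfolding r_def by (rule has_sum_mono[OF M.laplace_form_has_sum has_sum_cmult_left[OF m]])
    moreover have "0 \<le> m * (K\<^sup>2 * q)" using m0 q0 by simp
    ultimately have "M.laplace f \<bullet> f \<le> r + m * (K\<^sup>2 * q)" by argo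
    also have "\<dots> \<le> C * r + C * q"
    proof -
      have "r * 1 \<le> r * C" by (rule mult_left_mono) (use m0 in \<open>simp_all add: r_def C_def\<close>)
      then show ?thesis using q0 by (simp add: C_def algebra_simps)
    qed
    also have "\<dots> = C * (N.laplace f \<bullet> f)" by (simp add: q_def algebra_simps)
    finally show ?thesis .
  qed
  moreover have "C > 0" using m0 by (simp add: C_def add_pos_nonneg)
  ultimately show ?thesis using that by blast
qed

section \<open>Transfer to the operators on \<open>l2\<close>\<close>

lemma ell2_fun_Abs_ell2: "f \<in> l2 X \<Longrightarrow> ell2_fun (Abs_ell2 f) = f"
proof -
  assume f: "f \<in> l2 X"
  then have "(\<lambda>x. (cmod (f x))\<^sup>2) summable_on X" by (simp add: l2_def)
  then have "(\<lambda>x. (cmod (f x))\<^sup>2) summable_on UNIV"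
    by (rule summable_on_cong_neutral[THEN iffD1, rotated -1]) (use f in \<open>auto simp: l2_def\<close>)
  then show ?thesis by (intro Abs_ell2_inverse) simp
qed

context group
begin

lemma ell2_fun_in_l2_iff: "ell2_fun h \<in> l2 (carrier G) \<longleftrightarrow> carrier_restrict h = h"
proof
  assume "ell2_fun h \<in> l2 (carrier G)"
  then show "carrier_restrict h = h" by (intro ell2_eqI) (auto simp: ell2_fun_restrict l2_def)
next
  assume h: "carrier_restrict h = h"
  have "ell2_fun h x = 0" if "x \<notin> carrier G" for x
    using ell2_fun_restrict[of h x] h that by simp
  then show "ell2_fun h \<in> l2 (carrier G)" by (auto simp: l2_def ell2_summable)
qed

lemma restrict_Abs_ell2: "f \<in> l2 (carrier G) \<Longrightarrow> carrier_restrict (Abs_ell2 f) = Abs_ell2 f"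
  using ell2_fun_in_l2_iff[of "Abs_ell2 f"] by (simp add: ell2_fun_Abs_ell2)

lemma l2_inner_ell2_fun:
  assumes "carrier_restrict f = f"
  shows "l2_inner (carrier G) (ell2_fun f) (ell2_fun h) = Complex (f \<bullet> h) (f \<bullet> ell2_mult_i h)"
proof -
  have "ell2_fun f x = 0" if "x \<notin> carrier G" for x
    using ell2_fun_restrict[of f x] assms that by simp
  then have "l2_inner (carrier G) (ell2_fun f) (ell2_fun h) = (\<Sum>\<^sub>\<infinity>x. ell2_fun f x * cnj (ell2_fun h x))"
    unfolding l2_inner_def by (intro infsum_cong_neutral) auto
  then show ?thesis by (simp add: inner_ell2_def Im_ell2_sum[unfolded inner_ell2_def] complex_eq_iff)
qed

lemma l2_norm_ell2_fun:
  assumes "carrier_restrict f = f"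
  shows "l2_norm (carrier G) (ell2_fun f) = norm f"
proof -
  have "ell2_fun f x = 0" if "x \<notin> carrier G" for x
    using ell2_fun_restrict[of f x] assms that by simp
  then have "(\<Sum>\<^sub>\<infinity>x\<in>carrier G. (cmod (ell2_fun f x))\<^sup>2) = (\<Sum>\<^sub>\<infinity>x. (cmod (ell2_fun f x))\<^sup>2)"
    by (intro infsum_cong_neutral) auto
  then show ?thesis by (simp add: l2_norm_def flip: norm_ell2_square)
qed

text \<open>This product is the imaginary part of the complex number <A f, f>. Moving i and then A
  across the inner product shows that it is its own negative.\<close>

lemma symmetric_inner_mult_i_zero:
  assumes "symmetric_op A" "equivariant A"
  shows "A f \<bullet> ell2_mult_i f = 0"
proof -
  have "A f \<bullet> ell2_mult_i f = - (A (ell2_mult_i f) \<bullet> f)"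
    using assms(2) by (simp add: inner_ell2_mult_i_right equivariant_def)
  also have "\<dots> = - (A f \<bullet> ell2_mult_i f)"
    by (simp add: symmetric_opD(3)[OF assms(1)] inner_commute)
  finally show ?thesis by simp
qed

lemma equivariant_funpow: "equivariant A \<Longrightarrow> equivariant (A ^^ n)"
  by (induction n) (auto simp: equivariant_def)

end

context symmetric_walk
begin

lemma laplace_op_eq:
  assumes "carrier_restrict h = h"
  shows "laplace_op G \<mu> (ell2_fun h) = ell2_fun (laplace h)"
proof -
  have h: "ell2_fun h \<in> l2 (carrier G)" using assms by (simp add: ell2_fun_in_l2_iff)
  have "markov_op G \<mu> (ell2_fun h) x = ell2_fun (markov h) x" for x
  proof -
    have sum: "((\<lambda>g. pmf \<mu> g *\<^sub>R ell2_fun (right_shift g h) x) has_sum ell2_fun (markov h) x) (carrier G)"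
      by (rule markov_bounded_linear_has_sum[OF bounded_linear_ell2_fun])
    show ?thesis
    proof (cases "x \<in> carrier G")
      case True
      have "((\<lambda>g. ell2_fun h (x \<otimes> inv g) * complex_of_real (pmf \<mu> g)) has_sum ell2_fun (markov h) x) (carrier G)"
        using sum by (rule has_sum_cong[THEN iffD1, rotated])
          (use True in \<open>simp add: right_shift_def pull.rep_eq inj_mult scaleR_conv_of_real\<close>)
      then show ?thesis using h True by (simp add: markov_op_def infsumI)
    next
      case False
      have "((\<lambda>g. 0) has_sum ell2_fun (markov h) x) (carrier G)"
        using sum by (rule has_sum_cong[THEN iffD1, rotated]) (use False in \<open>simp add: right_shift_def pull.rep_eq\<close>)
      then have "ell2_fun (markov h) x = 0" using has_sum_unique has_sum_0_simp by blast
      then show ?thesis using h False by (simp add: markov_op_def)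
    qed
  qed
  then show ?thesis using h by (simp add: laplace_op_def laplace_def minus_ell2.rep_eq fun_eq_iff)
qed

lemma laplace_op_funpow:
  assumes "carrier_restrict h = h"
  shows "(laplace_op G \<mu> ^^ n) (ell2_fun h) = ell2_fun ((laplace ^^ n) h)"
proof (induction n)
  case (Suc n)
  have "carrier_restrict ((laplace ^^ n) h) = (laplace ^^ n) h"
    using equivariant_funpow[OF equivariant_laplace, of n] assms by (metis equivariant_def)
  then show ?case using Suc by (simp add: laplace_op_eq)
qed simp

text \<open>The complex form is real, so the moment conditions of the description are those
  satisfied by \<open>M\<close>. A competitor may have any bounds a, b; both measures are still
  compared on a common interval.\<close>

lemma spectral_measure_laplace_op:
  assumes h: "carrier_restrict h = h" and M: "spectral_measure_of laplace h 2 M"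
  shows "spectral_measure (carrier G) (laplace_op G \<mu>) (ell2_fun h) = M"
proof -
  have inner: "l2_inner (carrier G) ((laplace_op G \<mu> ^^ n) (ell2_fun h)) (ell2_fun h) =
      complex_of_real ((laplace ^^ n) h \<bullet> h)" for n
  proof -
    note eqv = equivariant_funpow[OF equivariant_laplace, of n]
    have "carrier_restrict ((laplace ^^ n) h) = (laplace ^^ n) h"
      using eqv h by (metis equivariant_def)
    then show ?thesis
      using symmetric_inner_mult_i_zero[OF symmetric_op_funpow[OF symmetric_op_laplace] eqv]
      by (simp add: laplace_op_funpow[OF h] l2_inner_ell2_fun complex_of_real_def)
  qed
  note M' = M[unfolded spectral_measure_of_def]
  show ?thesis
    unfolding spectral_measure_def inner of_real_eq_iff
  proof (rule the_equality)
    show "sets M = sets borel \<and> finite_measure M \<and> (\<exists>a b. AE t in M. a \<le> t \<and> t \<le> b) \<and>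
        (\<forall>n. (laplace ^^ n) h \<bullet> h = (\<integral>t. t ^ n \<partial>M))"
      using M' by blast
    fix N assume N: "sets N = sets borel \<and> finite_measure N \<and> (\<exists>a b. AE t in N. a \<le> t \<and> t \<le> b) \<and>
        (\<forall>n. (laplace ^^ n) h \<bullet> h = (\<integral>t. t ^ n \<partial>N))"
    then obtain a b where "AE t in N. a \<le> t \<and> t \<le> b" by blast
    then show "N = M"
      using N M' by (intro compact_measure_eq_by_moments[of N a b M 0 2]) auto
  qed
qed

text \<open>The description requires uniqueness as well as existence. A competitor is known only
  through its quadratic form, so it is identified by complex polarization.\<close>

lemma borel_calculus_laplace_op:
  assumes P: "orth_projection P" "equivariant P"
    and M: "\<And>f. spectral_measure_of laplace f 2 (M f)"
    and PM: "\<And>f. P f \<bullet> f = measure (M f) {..l}"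
  shows "borel_calculus (carrier G) (laplace_op G \<mu>) (indicator {..l}) =
    (\<lambda>f\<in>l2 (carrier G). ell2_fun (P (Abs_ell2 f)))"
proof -
  let ?X = "carrier G" and ?L = "laplace_op G \<mu>"
  note P' = orth_projectionD[OF P(1)]
  have Pres: "carrier_restrict (P h) = P h" if "carrier_restrict h = h" for h
    using P(2) that by (metis equivariant_def)
  have int: "(\<integral>t. indicator {..l} t \<partial>spectral_measure ?X ?L (ell2_fun h)) = P h \<bullet> h"
    if "carrier_restrict h = h" for h
  proof -
    have "sets (M h) = sets borel" using M by (simp add: spectral_measure_of_def)
    moreover from this have "space (M h) = UNIV" by (metis sets_eq_imp_space_eq space_borel)
    ultimately show ?thesis
      using spectral_measure_laplace_op[OF that M] PM by simp
  qed
  have innerP: "l2_inner ?X (ell2_fun (P h)) (ell2_fun h) = complex_of_real (P h \<bullet> h)"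
    if "carrier_restrict h = h" for h
    using symmetric_inner_mult_i_zero[OF P'(1) P(2)] Pres[OF that]
    by (simp add: l2_inner_ell2_fun complex_of_real_def)
  define T where "T = (\<lambda>f\<in>l2 ?X. ell2_fun (P (Abs_ell2 f)))"
  have T_eq: "T (ell2_fun h) = ell2_fun (P h)" if "carrier_restrict h = h" for h
    using that by (simp add: T_def ell2_fun_in_l2_iff ell2_fun_inverse)
  have l2E: "\<exists>h. f = ell2_fun h \<and> carrier_restrict h = h" if "f \<in> l2 ?X" for f
    using that ell2_fun_Abs_ell2 restrict_Abs_ell2 by metis
  \<comment> \<open>Complex scalars act through real scaling and multiplication by i, so complex
    homogeneity of \<open>T\<close> follows from real linearity of \<open>P\<close> and its
    commutation with i.\<close>
  have scale: "(\<lambda>x. c * ell2_fun h x) = ell2_fun (Re c *\<^sub>R h + Im c *\<^sub>R ell2_mult_i h)" for c h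
    by (rule ext) (simp add: plus_ell2.rep_eq scaleR_ell2.rep_eq ell2_mult_i.rep_eq complex_eq_iff)
  note rlin = bounded_linear.linear[OF bounded_linear_shifts(3)]
  have res_scale: "carrier_restrict (Re c *\<^sub>R h + Im c *\<^sub>R ell2_mult_i h) = Re c *\<^sub>R h + Im c *\<^sub>R ell2_mult_i h"
    if "carrier_restrict h = h" for c h
    using that by (simp add: linear_add[OF rlin] linear_scale[OF rlin] shift_mult_i)
  have PJ: "P (ell2_mult_i h) = ell2_mult_i (P h)" for h using P(2) by (simp add: equivariant_def)
  have "bounded_op ?X T"
    unfolding bounded_op_def
  proof (intro conjI ballI allI)
    show "T \<in> l2 ?X \<rightarrow>\<^sub>E l2 ?X"
    proof (rule PiE_I)
      fix f assume "f \<in> l2 ?X"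
      then obtain h where h: "f = ell2_fun h" "carrier_restrict h = h" using l2E by blast
      then show "T f \<in> l2 ?X" by (simp add: T_eq ell2_fun_in_l2_iff Pres)
    qed (simp add: T_def)
    fix f assume "f \<in> l2 ?X"
    then obtain h where h: "f = ell2_fun h" "carrier_restrict h = h" using l2E by blast
    show "T (\<lambda>x. c * f x) = (\<lambda>x. c * T f x)" for c
      using h res_scale[OF h(2), of c]
      by (simp add: scale T_eq linear_add[OF P'(3)] linear_scale[OF P'(3)] PJ)
    fix f' assume "f' \<in> l2 ?X"
    then obtain h' where h': "f' = ell2_fun h'" "carrier_restrict h' = h'" using l2E by blast
    have "carrier_restrict (h + h') = h + h'" using h h' by (simp add: linear_add[OF rlin])
    then show "T (\<lambda>x. f x + f' x) = (\<lambda>x. T f x + T f' x)"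
      using h h' by (simp add: T_eq linear_add[OF P'(3)] flip: plus_ell2.rep_eq)
  next
    show "\<exists>K. \<forall>f\<in>l2 ?X. l2_norm ?X (T f) \<le> K * l2_norm ?X f"
    proof (intro exI[of _ 1] ballI)
      fix f assume "f \<in> l2 ?X"
      then obtain h where h: "f = ell2_fun h" "carrier_restrict h = h" using l2E by blast
      then show "l2_norm ?X (T f) \<le> 1 * l2_norm ?X f"
        by (simp add: T_eq l2_norm_ell2_fun Pres P'(7))
    qed
  qed
  moreover have "l2_inner ?X (T f) f = complex_of_real (\<integral>t. indicator {..l} t \<partial>spectral_measure ?X ?L f)"
    if f: "f \<in> l2 ?X" for f
  proof -
    obtain h where h: "f = ell2_fun h" "carrier_restrict h = h" using l2E[OF f] by blast
    show ?thesis using innerP[OF h(2)] int[OF h(2)] T_eq[OF h(2)] by (simp add: h(1))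
  qed
  moreover have "T' = T"
    if T': "bounded_op ?X T' \<and> (\<forall>f\<in>l2 ?X. l2_inner ?X (T' f) f =
      complex_of_real (\<integral>t. indicator {..l} t \<partial>spectral_measure ?X ?L f))" for T'
  proof -
    let ?R = "carrier_restrict"
    have T'_l2: "T' f \<in> l2 ?X" if "f \<in> l2 ?X" for f
      using T' that unfolding bounded_op_def by blast
    have R_l2: "ell2_fun (?R h) \<in> l2 ?X" for h by (simp add: ell2_fun_in_l2_iff restrict_restrict)
    \<comment> \<open>The competitor is controlled only on functions supported on the group.
      Precomposing with the restriction yields an operator on the whole space, to which
      \<open>complex_linear_zeroI\<close> applies.\<close>
    define E where "E h = Abs_ell2 (T' (ell2_fun (?R h)))" for h
    have E: "ell2_fun (E h) = T' (ell2_fun (?R h))" "?R (E h) = E h" for h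
      unfolding E_def using ell2_fun_Abs_ell2 restrict_Abs_ell2 T'_l2 R_l2 by blast+
    define D where "D h = E h - P (?R h)" for h
    have "D h = 0" for h
    proof (rule complex_linear_zeroI[where D = D])
      fix f h
      have "ell2_fun (E (f + h)) x = ell2_fun (E f) x + ell2_fun (E h) x" for x
        using T' R_l2[of f] R_l2[of h]
        by (simp add: E linear_add[OF rlin] plus_ell2.rep_eq[abs_def] bounded_op_def)
      then have "E (f + h) = E f + E h" by (intro ell2_eqI) (simp add: plus_ell2.rep_eq)
      then show "D (f + h) = D f + D h"
        by (simp add: D_def linear_add[OF rlin] linear_add[OF P'(3)])
      have "ell2_fun (E (ell2_mult_i f)) x = \<i> * ell2_fun (E f) x" for x
        using T' R_l2[of f] by (simp add: E shift_mult_i ell2_mult_i.rep_eq[abs_def] bounded_op_def)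
      then have "E (ell2_mult_i f) = ell2_mult_i (E f)" by (intro ell2_eqI) (simp add: ell2_mult_i.rep_eq)
      then show "D (ell2_mult_i f) = ell2_mult_i (D f)"
        by (simp add: D_def shift_mult_i PJ linear_diff[OF linear_ell2_mult_i])
      have "Complex (E f \<bullet> ?R f) (E f \<bullet> ell2_mult_i (?R f)) = complex_of_real (P (?R f) \<bullet> ?R f)"
        using T' R_l2[of f] int[of "?R f"] l2_inner_ell2_fun[OF E(2), of f "?R f"]
        by (simp add: E(1) restrict_restrict)
      then have Ef: "E f \<bullet> ?R f = P (?R f) \<bullet> ?R f" "E f \<bullet> ell2_mult_i (?R f) = 0"
        by (auto simp: complex_eq_iff)
      have res: "?R (D f) = D f"
        unfolding D_def using E(2)[of f] Pres[of "?R f"] by (simp add: linear_diff[OF rlin] restrict_restrict)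
      have "D f \<bullet> f = D f \<bullet> ?R f" using inner_restrict[of "D f" f] res by simp
      then show "D f \<bullet> f = 0" using Ef by (simp add: D_def inner_diff_left)
      have "D f \<bullet> ell2_mult_i f = D f \<bullet> ell2_mult_i (?R f)"
        using inner_restrict[of "D f" "ell2_mult_i f"] res by (simp add: shift_mult_i)
      then show "D f \<bullet> ell2_mult_i f = 0"
        using Ef symmetric_inner_mult_i_zero[OF P'(1) P(2), of "?R f"] by (simp add: D_def inner_diff_left)
    qed
    then have EP: "E h = P (?R h)" for h by (simp add: D_def)
    have "T' f = T f" if f: "f \<in> l2 ?X" for f
    proof -
      obtain h where h: "f = ell2_fun h" "?R h = h" using l2E[OF f] by blast
      show ?thesis using E(1)[of h] EP[of h] h T_eq by simp
    qed
    \<comment> \<open>Off \<open>l2\<close> both maps take the default value of extensional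
      functions, so agreement on \<open>l2\<close> gives equality.\<close>
    moreover have "T' \<in> extensional (l2 ?X)" "T \<in> extensional (l2 ?X)"
      using T' by (auto simp: bounded_op_def PiE_def T_def)
    ultimately show ?thesis by (intro extensionalityI[of T' "l2 ?X" T]) auto
  qed
  ultimately show ?thesis
    unfolding borel_calculus_def T_def[symmetric] by (intro the_equality) blast+
qed

text \<open>The spectral measures are returned along with the projection because the comparison uses
  that a vector killed by the projection has no spectral mass in the half-line.\<close>

lemma spectral_distribution_eq_trace:
  obtains P M where "orth_projection P" "equivariant P"
    "\<And>f. spectral_measure_of laplace f 2 (M f)" "\<And>f. P f \<bullet> f = measure (M f) {..l}"
    "\<And>f. laplace (P f) \<bullet> P f \<le> l * (P f \<bullet> P f)"
    "spectral_distribution G \<mu> l = P (ell2_delta \<one>) \<bullet> ell2_delta \<one>"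
proof -
  obtain M where M: "\<And>f. spectral_measure_of laplace f 2 (M f)"
    using spectral_measure_of_exists[OF symmetric_op_laplace _ laplace_bounds] by (metis zero_less_numeral)
  obtain P where P: "orth_projection P" "\<And>f. P f \<bullet> f = measure (M f) {..l}"
    "\<And>f. laplace (P f) \<bullet> P f \<le> l * (P f \<bullet> P f)"
    "\<And>B f. bounded_linear B \<Longrightarrow> \<forall>f. B (laplace f) = laplace (B f) \<Longrightarrow> B (P f) = P (B f)"
    using spectral_projection_exists[OF symmetric_op_laplace M, of l] by auto
  have eqv: "equivariant P" by (rule equivariant_if_commutes[OF P(4)])
  have d: "point_mass \<one> = ell2_fun (ell2_delta \<one>)" by (simp add: ell2_delta.rep_eq)
  have "ell2_fun (ell2_delta \<one>) \<in> l2 (carrier G)" by (simp add: ell2_fun_in_l2_iff restrict_delta)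
  then have "spectral_projection (carrier G) (laplace_op G \<mu>) l (point_mass \<one>) = ell2_fun (P (ell2_delta \<one>))"
    unfolding spectral_projection_def borel_calculus_laplace_op[OF P(1) eqv M P(2)] d
    by (simp add: ell2_fun_inverse)
  moreover have "carrier_restrict (P (ell2_delta \<one>)) = P (ell2_delta \<one>)"
    using eqv restrict_delta by (metis equivariant_def)
  ultimately have trace: "spectral_distribution G \<mu> l = P (ell2_delta \<one>) \<bullet> ell2_delta \<one>"
    by (simp add: spectral_distribution_def group_trace_def d l2_inner_ell2_fun)
  show ?thesis by (rule that[OF P(1) eqv M P(2,3) trace])
qed

end

section \<open>Comparison of the spectral distributions\<close>

lemma (in group) spectral_distribution_dil_le:
  assumes \<mu>: "admissible G \<mu>" and \<nu>: "admissible G \<nu>"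
  shows "dil_le (spectral_distribution G \<nu>) (spectral_distribution G \<mu>)"
proof -
  interpret M: symmetric_walk G \<mu> by (rule admissible_symmetric_walk[OF \<mu>])
  interpret N: symmetric_walk G \<nu> by (rule admissible_symmetric_walk[OF \<nu>])
  obtain C where C: "C > 0" "\<And>f. M.laplace f \<bullet> f \<le> C * (N.laplace f \<bullet> f)"
    by (rule laplace_form_comparison[OF \<mu> \<nu>]) (rule that)
  have "spectral_distribution G \<nu> l \<le> spectral_distribution G \<mu> (C * l)" for l
  proof -
    obtain P K where P: "orth_projection P" "equivariant P"
      "\<And>f. spectral_measure_of N.laplace f 2 (K f)" "\<And>f. P f \<bullet> f = measure (K f) {..l}"
      "\<And>f. N.laplace (P f) \<bullet> P f \<le> l * (P f \<bullet> P f)"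
      "spectral_distribution G \<nu> l = P (ell2_delta \<one>) \<bullet> ell2_delta \<one>"
      by (rule N.spectral_distribution_eq_trace[of l]) (rule that)
    obtain Q K where Q: "orth_projection Q" "equivariant Q"
      "\<And>f. spectral_measure_of M.laplace f 2 (K f)" "\<And>f. Q f \<bullet> f = measure (K f) {..C * l}"
      "\<And>f. M.laplace (Q f) \<bullet> Q f \<le> C * l * (Q f \<bullet> Q f)"
      "spectral_distribution G \<mu> (C * l) = Q (ell2_delta \<one>) \<bullet> ell2_delta \<one>"
      by (rule M.spectral_distribution_eq_trace[of "C * l"]) (rule that)
    \<comment> \<open>A vector in the range of \<open>P\<close> has \<nu>-form at most l |f|^2,
      hence \<mu>-form at most C l |f|^2. If \<open>Q\<close> kills it, it has no \<mu>-spectral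
      mass up to C l, and a nonzero f would have \<mu>-form strictly above C l |f|^2.\<close>
    have "f = 0" if "P f = f" "Q f = 0" for f
    proof (rule ccontr)
      assume "f \<noteq> 0"
      moreover have "measure (K f) {..C * l} = 0" using Q(4)[of f] that by simp
      ultimately have "C * l * (f \<bullet> f) < M.laplace f \<bullet> f" using spectral_form_gt[OF Q(3)] by blast
      also have "\<dots> \<le> C * (N.laplace f \<bullet> f)" by (rule C)
      also have "\<dots> \<le> C * (l * (f \<bullet> f))"
        using P(5)[of f] that C(1) by (intro mult_left_mono) auto
      finally show False by simp
    qed
    then show ?thesis unfolding P(6) Q(6) by (rule equivariant_projection_trace_le[OF P(1,2) Q(1,2)])
  qed
  \<comment> \<open>The inequality holds for every l, so the dilation factor is \<open>C\<close> and
    the threshold 1 is an arbitrary choice.\<close>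
  then show ?thesis
    unfolding dil_le_def using C(1) by (intro exI[of _ C] conjI exI[of _ 1]) auto
qed

theorem theorem1p10:
  fixes G :: "('a, 'b) monoid_scheme" and \<mu>\<^sub>1 \<mu>\<^sub>2 :: "'a pmf"
  assumes "group G"
    and "finitely_generated G"
    and "admissible G \<mu>\<^sub>1"
    and "admissible G \<mu>\<^sub>2"
  shows "dil_equiv (spectral_distribution G \<mu>\<^sub>1) (spectral_distribution G \<mu>\<^sub>2)"
  using group.spectral_distribution_dil_le[OF assms(1,4,3)] group.spectral_distribution_dil_le[OF assms(1,3,4)]
  by (simp add: dil_equiv_def)

end
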